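(* Let $K$ be a field, $n>0$, $B=K[x_1,\dots,x_n]$, and let $\varphi:B\to B$ be a $K$-algebra homomorphism with $A=\varphi(B)$. Let $e=\deg(\varphi)$ and $m=2^n e^{n-1}(n+e^n)$. The following are equivalent: (i) $\varphi$ is integral, i.e. $B$ is integral over $A$; (ii) there exist monic polynomials $F_1,\dots,F_n\in A[T]$, each of degree $e^n$ and with all coefficients in $\varphi(B_{\le m})$, such that $F_i(x_i)=0$ for $i=1,\dots,n$.
   Context: $\deg(\varphi)=\max\{\deg\varphi(x_1),\dots,\deg\varphi(x_n)\}$ with $\deg$ the total degree; $B_{\le d}$ denotes the $K$-subspace of polynomials of total degree $\le d$. *)

theory Defs
  imports "HOL-Library.Poly_Mapping" "HOL-Computational_Algebra.Polynomial"
begin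

text \<open>Polynomial ring K[x_v : v in 'v] in finitely many variables indexed by a finite
type 'v (so n = CARD('v) > 0), represented as finitely supported maps from
monomials (exponent vectors 'v =>0 nat) to coefficients.\<close>

type_synonym ('v, 'k) mpoly = "('v \<Rightarrow>\<^sub>0 nat) \<Rightarrow>\<^sub>0 'k"

definition mconst :: "'k::zero \<Rightarrow> ('v, 'k) mpoly" where
  "mconst c = Poly_Mapping.single 0 c"

definition mvar :: "'v \<Rightarrow> ('v, 'k::{zero,one}) mpoly" where
  "mvar i = Poly_Mapping.single (Poly_Mapping.single i 1) 1"

text \<open>total degree of a monomial and of a polynomial (degree of 0 taken to be 0)\<close>
definition mon_deg :: "('v \<Rightarrow>\<^sub>0 nat) \<Rightarrow> nat" where
  "mon_deg m = (\<Sum>i\<in>Poly_Mapping.keys m. Poly_Mapping.lookup m i)"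

definition tdeg :: "('v, 'k::zero) mpoly \<Rightarrow> nat" where
  "tdeg p = Max (insert 0 (mon_deg ` Poly_Mapping.keys p))"

definition is_K_alg_hom :: "(('v, 'k::comm_ring_1) mpoly \<Rightarrow> ('v, 'k) mpoly) \<Rightarrow> bool" where
  "is_K_alg_hom \<phi> \<longleftrightarrow>
     (\<forall>p q. \<phi> (p + q) = \<phi> p + \<phi> q) \<and>
     (\<forall>p q. \<phi> (p * q) = \<phi> p * \<phi> q) \<and>
     \<phi> 1 = 1 \<and>
     (\<forall>c. \<phi> (mconst c) = mconst c)"

definition hom_deg :: "(('v::finite, 'k::{zero,one}) mpoly \<Rightarrow> ('v, 'k) mpoly) \<Rightarrow> nat" where
  "hom_deg \<phi> = Max (range (\<lambda>i. tdeg (\<phi> (mvar i))))"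

definition integral_hom :: "(('v, 'k::comm_ring_1) mpoly \<Rightarrow> ('v, 'k) mpoly) \<Rightarrow> bool" where
  "integral_hom \<phi> \<longleftrightarrow>
     (\<forall>b. \<exists>F :: ('v, 'k) mpoly poly.
        lead_coeff F = 1 \<and> (\<forall>j. coeff F j \<in> range \<phi>) \<and> poly F b = 0)"

end

theory Submission
  imports Defs "Jordan_Normal_Form.Char_Poly"
begin

text \<open>
  Write \<open>f\<close> for the images of the variables and \<open>x\<close> for one of the variables. There are more
  monomials \<open>y\<^sup>a T\<^sup>j\<close> with \<open>|a| \<le> m\<close> and \<open>j \<le> e\<^sup>n\<close> than monomials of degree at most \<open>e m + e\<^sup>n\<close>,
  which bounds the degree of their values at \<open>(f, x)\<close>; hence \<open>(f, x)\<close> satisfies a nonzero relation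
  \<open>P\<close> within these bounds.

  If \<open>\<phi>\<close> is integral, then it is injective and the ideal of relations in \<open>K[y][T]\<close> is generated by a
  monic polynomial \<open>F\<close>: a relation of least degree in \<open>T\<close> divides, up to a factor from \<open>K[y]\<close>, a monic
  one, and by the Dedekind--Mertens formula its coefficients divided by the leading one are almost
  integral over \<open>K[y]\<close>, which is completely integrally closed. Since \<open>F\<close> divides \<open>P\<close> and degrees are
  additive, \<open>F\<close> obeys the same bounds, and multiplying by a power of \<open>T\<close> makes its degree exactly \<open>e\<^sup>n\<close>.

  Conversely, monic equations for the variables make \<open>B\<close> a finite module over \<open>A\<close>, and Cramer's rule
  yields integrality.
\<close>

hide_const (open) Module.smult

abbreviation (input) lookup where "lookup \<equiv> Poly_Mapping.lookup"
abbreviation (input) keys where "keys \<equiv> Poly_Mapping.keys"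
abbreviation (input) single where "single \<equiv> Poly_Mapping.single"

section \<open>Leading monomials and total degree\<close>

lemma mon_deg_eq_sum: "mon_deg (m :: 'v::finite \<Rightarrow>\<^sub>0 nat) = (\<Sum>i\<in>UNIV. lookup m i)"
  unfolding mon_deg_def by (rule sum.mono_neutral_left) (auto simp: in_keys_iff)

lemma mon_deg_add: "mon_deg (a + b :: 'v::finite \<Rightarrow>\<^sub>0 nat) = mon_deg a + mon_deg b"
  by (simp add: mon_deg_eq_sum lookup_add sum.distrib)

lemma mon_deg_zero [simp]: "mon_deg 0 = 0"
  by (simp add: mon_deg_def)

lemma mon_deg_single [simp]: "mon_deg (single i k) = k"
  by (simp add: mon_deg_def)

section \<open>An injective multiplicative code for exponent vectors\<close>

lemma exists_prime_labelling: "\<exists>f :: 'v::finite \<Rightarrow> nat. inj f \<and> (\<forall>v. prime (f v))"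
proof -
  have "infinite {p::nat. prime p}" by (rule primes_infinite)
  then obtain h :: "nat \<Rightarrow> nat" where h: "inj h" "range h \<subseteq> {p. prime p}"
    by (meson infinite_countable_subset)
  obtain t :: "'v \<Rightarrow> nat" where "inj t" using finite_imp_inj_to_nat_seg[OF finite_UNIV] by blast
  then have "inj (h \<circ> t)" using h(1) by (rule inj_compose[rotated])
  moreover have "\<forall>v. prime ((h \<circ> t) v)" using h(2) by auto
  ultimately show ?thesis by blast
qed

definition var_prime :: "'v::finite \<Rightarrow> nat" where
  "var_prime = (SOME f. inj f \<and> (\<forall>v. prime (f v)))"

lemma var_prime: "inj (var_prime :: 'v::finite \<Rightarrow> nat)" "prime (var_prime (v :: 'v))"
proof -
  have "inj (var_prime :: 'v \<Rightarrow> nat) \<and> (\<forall>v :: 'v. prime (var_prime v))"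
    unfolding var_prime_def by (rule someI_ex[OF exists_prime_labelling])
  then show "inj (var_prime :: 'v \<Rightarrow> nat)" "prime (var_prime v)" by auto
qed

text \<open>The code turns addition of exponent vectors into multiplication of positive integers,
  which respects strict inequality; comparing codes is therefore compatible with multiplying
  monomials.\<close>

definition mon_code :: "('v::finite \<Rightarrow>\<^sub>0 nat) \<Rightarrow> nat" where
  "mon_code m = (\<Prod>i\<in>UNIV. var_prime i ^ lookup m i)"

lemma mon_code_add: "mon_code (a + b) = mon_code a * mon_code b"
  by (simp add: mon_code_def lookup_add power_add prod.distrib)

lemma mon_code_pos: "mon_code m > 0"
  unfolding mon_code_def by (intro prod_pos ballI zero_less_power prime_gt_0_nat var_prime(2))

text \<open>Unique factorisation recovers every exponent, whence the code is injective.\<close>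

lemma multiplicity_mon_code: "multiplicity (var_prime i) (mon_code m) = lookup m i"
proof -
  have "multiplicity (var_prime i) (mon_code m)
      = (\<Sum>j\<in>UNIV. multiplicity (var_prime i) (var_prime j ^ lookup m j))"
    unfolding mon_code_def
  proof (rule prime_elem_multiplicity_prod_distrib)
    show "prime_elem (var_prime i)" using var_prime(2) by blast
    show "0 \<notin> range (\<lambda>i. var_prime i ^ lookup m i)"
      using var_prime(2) not_prime_0 by (metis (no_types, lifting) image_iff power_not_zero)
  qed simp
  also have "\<dots> = (\<Sum>j\<in>UNIV. if j = i then lookup m i else 0)"
  proof (rule sum.cong[OF refl])
    fix j
    show "multiplicity (var_prime i) (var_prime j ^ lookup m j) = (if j = i then lookup m i else 0)"
    proof (cases "j = i")
      case True
      have "\<not> is_unit (var_prime i)" using var_prime(2)[of i] by (meson not_prime_unit)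
      moreover have "var_prime i \<noteq> 0" using var_prime(2)[of i] by auto
      ultimately show ?thesis using True by (simp add: multiplicity_same_power)
    next
      case False
      then have "var_prime i \<noteq> var_prime j" using var_prime(1) by (auto dest: injD)
      then show ?thesis using False
        by (simp add: multiplicity_distinct_prime_power var_prime(2))
    qed
  qed
  finally show ?thesis by simp
qed

lemma mon_code_inj: "mon_code a = mon_code b \<Longrightarrow> a = b"
  by (metis multiplicity_mon_code poly_mapping_eqI)

text \<open>Breaking ties by the Goedel number avoids choosing a linear order on the variables.\<close>
definition mon_less :: "('v::finite \<Rightarrow>\<^sub>0 nat) \<Rightarrow> ('v \<Rightarrow>\<^sub>0 nat) \<Rightarrow> bool" where
  "mon_less a b \<longleftrightarrow> mon_deg a < mon_deg b \<or> mon_deg a = mon_deg b \<and> mon_code a < mon_code b"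

lemma mon_less_irrefl: "\<not> mon_less a a"
  by (simp add: mon_less_def)

lemma mon_less_trans: "mon_less a b \<Longrightarrow> mon_less b c \<Longrightarrow> mon_less a c"
  by (auto simp: mon_less_def)

lemma mon_less_total: "a \<noteq> b \<Longrightarrow> mon_less a b \<or> mon_less b a"
  by (auto simp: mon_less_def dest: mon_code_inj) (meson mon_code_inj nat_neq_iff)

lemma mon_less_add: "mon_less a b \<Longrightarrow> mon_less (a + c) (b + c)"
  by (auto simp: mon_less_def mon_deg_add mon_code_add mon_code_pos)

lemma wfp_mon_less: "wfp mon_less"
proof -
  have "wf (inv_image (less_than <*lex*> less_than) (\<lambda>m. (mon_deg m, mon_code m)))"
    by (intro wf_inv_image wf_lex_prod wf_less_than)
  then show ?thesis
    unfolding wfp_def by (rule wf_subset) (auto simp: mon_less_def inv_image_def)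
qed

text \<open>A relation rather than a function: the zero polynomial has no leading monomial, so no
  default value is involved.\<close>

definition is_lead :: "('v::finite, 'k::zero) mpoly \<Rightarrow> ('v \<Rightarrow>\<^sub>0 nat) \<Rightarrow> bool" where
  "is_lead p a \<longleftrightarrow> a \<in> keys p \<and> (\<forall>b\<in>keys p. b \<noteq> a \<longrightarrow> mon_less b a)"

lemma ex_mon_greatest:
  "finite S \<Longrightarrow> S \<noteq> {} \<Longrightarrow> \<exists>a\<in>S. \<forall>b\<in>S. b \<noteq> a \<longrightarrow> mon_less b a"
proof (induction S rule: finite_ne_induct)
  case (insert x F)
  then obtain a where a: "a \<in> F" "\<forall>b\<in>F. b \<noteq> a \<longrightarrow> mon_less b a" by blast
  show ?case
  proof (cases "mon_less x a")
    case True
    then show ?thesis using a by auto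
  next
    case False
    then have "mon_less a x" using mon_less_total[of x a] a insert by auto
    then show ?thesis using a by (intro bexI[of _ x]) (auto intro: mon_less_trans)
  qed
qed auto

lemma ex_is_lead: "p \<noteq> 0 \<Longrightarrow> \<exists>a. is_lead p a"
  using ex_mon_greatest[of "keys p"] by (auto simp: is_lead_def)

lemma is_lead_unique: "is_lead p a \<Longrightarrow> is_lead p b \<Longrightarrow> a = b"
  by (metis is_lead_def mon_less_irrefl mon_less_trans)

section \<open>Leading monomials of products\<close>

lemma sum_monomials: "(\<Sum>a\<in>keys p. single a (lookup p a)) = p"
  by (rule poly_mapping_eqI) (auto simp: lookup_sum lookup_single when_def in_keys_iff)

lemma lookup_mult_sum:
  fixes p q :: "('v, 'k::comm_ring_1) mpoly"
  shows "lookup (p * q) c = (\<Sum>a\<in>keys p. \<Sum>b\<in>keys q. lookup p a * lookup q b when a + b = c)"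
proof -
  have "p * q = (\<Sum>a\<in>keys p. single a (lookup p a)) * (\<Sum>b\<in>keys q. single b (lookup q b))"
    by (simp add: sum_monomials)
  also have "\<dots> = (\<Sum>a\<in>keys p. \<Sum>b\<in>keys q. single (a + b) (lookup p a * lookup q b))"
    by (simp add: sum_product mult_single)
  finally show ?thesis by (simp add: lookup_sum lookup_single)
qed

text \<open>The order is strictly compatible with addition, so the top sum of exponents arises from
  the two leading monomials only; no cancellation can occur there.\<close>

lemma is_lead_add_eq:
  assumes "is_lead p a" "is_lead q b" "c \<in> keys p" "d \<in> keys q"
  shows "c = a \<and> d = b \<or> mon_less (c + d) (a + b)"
proof -
  consider "c = a" "d = b" | "c = a" "mon_less d b" | "mon_less c a" "d = b"
    | "mon_less c a" "mon_less d b"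
    using assms by (auto simp: is_lead_def)
  then show ?thesis
    by cases (metis mon_less_add mon_less_trans add.commute)+
qed

lemma lookup_mult_lead:
  fixes p q :: "('v::finite, 'k::comm_ring_1) mpoly"
  assumes "is_lead p a" "is_lead q b"
  shows "lookup (p * q) (a + b) = lookup p a * lookup q b"
proof -
  have "lookup (p * q) (a + b)
      = (\<Sum>c\<in>keys p. \<Sum>d\<in>keys q. if c = a \<and> d = b then lookup p a * lookup q b else 0)"
    unfolding lookup_mult_sum
    by (intro sum.cong refl)
      (auto simp: when_def dest: is_lead_add_eq[OF assms] simp: mon_less_irrefl)
  also have "\<dots> = (\<Sum>c\<in>keys p. if c = a then lookup p a * lookup q b else 0)"
    using assms by (intro sum.cong refl) (auto simp: is_lead_def)
  finally show ?thesis using assms by (auto simp: is_lead_def)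
qed

lemma is_lead_mult:
  fixes p q :: "('v::finite, 'k::field) mpoly"
  assumes "is_lead p a" "is_lead q b"
  shows "is_lead (p * q) (a + b)"
  unfolding is_lead_def
proof (intro conjI ballI impI)
  show "a + b \<in> keys (p * q)"
    using lookup_mult_lead[OF assms] assms by (auto simp: is_lead_def in_keys_iff)
  fix e assume e: "e \<in> keys (p * q)" "e \<noteq> a + b"
  then obtain c d where "c \<in> keys p" "d \<in> keys q" "e = c + d"
    using keys_mult[of p q] by blast
  then show "mon_less e (a + b)" using is_lead_add_eq[OF assms] e by blast
qed

lemma mpoly_mult_nonzero:
  fixes p q :: "('v::finite, 'k::field) mpoly"
  assumes "p \<noteq> 0" "q \<noteq> 0"
  shows "p * q \<noteq> 0"
  using assms ex_is_lead is_lead_mult by (metis empty_iff is_lead_def keys_zero)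

lemma mpoly_mult_eq_0: "p * q = 0 \<longleftrightarrow> p = 0 \<or> (q :: ('v::finite, 'k::field) mpoly) = 0"
  using mpoly_mult_nonzero by auto

lemma mpoly_mult_left_cancel:
  "c \<noteq> 0 \<Longrightarrow> c * p = c * (q :: ('v::finite, 'k::field) mpoly) \<longleftrightarrow> p = q"
  using mpoly_mult_eq_0[of c "p - q"] by (auto simp: algebra_simps)

lemma mpoly_power_nonzero: "p \<noteq> 0 \<Longrightarrow> (p :: ('v::finite, 'k::field) mpoly) ^ n \<noteq> 0"
  by (induction n) (auto simp: mpoly_mult_eq_0)

section \<open>Total degree read off from leading monomials\<close>

lemma tdeg_le_iff: "tdeg p \<le> d \<longleftrightarrow> (\<forall>a\<in>keys p. mon_deg a \<le> d)"
  unfolding tdeg_def by (subst Max_le_iff) auto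

text \<open>\<open>mon_less\<close> compares total degrees first.\<close>

lemma tdeg_is_lead: "is_lead p a \<Longrightarrow> tdeg p = mon_deg a"
  unfolding is_lead_def tdeg_def by (intro Max_eqI) (auto simp: mon_less_def)

lemma tdeg_zero [simp]: "tdeg 0 = 0"
  by (simp add: tdeg_def)

lemma tdeg_one [simp]: "tdeg (1 :: ('v::finite, 'k::comm_ring_1) mpoly) = 0"
  by (simp add: tdeg_def)

lemma tdeg_mult:
  fixes p q :: "('v::finite, 'k::field) mpoly"
  assumes "p \<noteq> 0" "q \<noteq> 0"
  shows "tdeg (p * q) = tdeg p + tdeg q"
  using assms ex_is_lead is_lead_mult tdeg_is_lead mon_deg_add by metis

lemma tdeg_mult_le: "tdeg (p * q :: ('v::finite, 'k::field) mpoly) \<le> tdeg p + tdeg q"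
  by (cases "p = 0 \<or> q = 0") (auto simp: tdeg_mult)

lemma tdeg_add_le: "tdeg p \<le> d \<Longrightarrow> tdeg q \<le> d \<Longrightarrow> tdeg (p + q) \<le> d"
  unfolding tdeg_le_iff using keys_add[of p q] by blast

lemma tdeg_sum_le: "(\<And>x. x \<in> S \<Longrightarrow> tdeg (f x) \<le> d) \<Longrightarrow> tdeg (\<Sum>x\<in>S. f x) \<le> d"
  by (induction S rule: infinite_finite_induct) (auto intro!: tdeg_add_le)

section \<open>Polynomial rings are completely integrally closed\<close>

lemma is_lead_power:
  fixes p :: "('v::finite, 'k::field) mpoly"
  assumes "is_lead p a"
  shows "\<exists>b. is_lead (p ^ k) b \<and> (\<forall>i. lookup b i = k * lookup a i)"
proof (induction k)
  case 0
  show ?case by (rule exI[of _ 0]) (simp add: is_lead_def)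
next
  case (Suc k)
  then obtain b where "is_lead (p ^ k) b" "\<forall>i. lookup b i = k * lookup a i" by blast
  then show ?case using is_lead_mult[OF assms]
    by (intro exI[of _ "a + b"]) (auto simp: lookup_add)
qed

text \<open>One step of multivariate division: the term multiple of \<open>b\<close> that cancels
  the leading term of \<open>a\<close> is subtracted. Quantifying over the leading monomials of the
  difference also covers the difference zero.\<close>

lemma lead_reduction:
  fixes a b :: "('v::finite, 'k::field) mpoly"
  assumes a: "is_lead a \<alpha>" and b: "is_lead b \<beta>" and le: "\<And>i. lookup \<beta> i \<le> lookup \<alpha> i"
  shows "\<exists>u. \<forall>\<alpha>'. is_lead (a - u * b) \<alpha>' \<longrightarrow> mon_less \<alpha>' \<alpha>"
proof (intro exI allI impI)
  define u where "u = single (\<alpha> - \<beta>) (lookup a \<alpha> / lookup b \<beta>)"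
  have sum: "\<alpha> - \<beta> + \<beta> = \<alpha>"
    by (rule poly_mapping_eqI) (use le in \<open>simp add: lookup_add lookup_minus\<close>)
  have nz: "lookup a \<alpha> \<noteq> 0" "lookup b \<beta> \<noteq> 0"
    using a b by (auto simp: is_lead_def in_keys_iff)
  then have u_lead: "is_lead u (\<alpha> - \<beta>)" by (simp add: u_def is_lead_def)
  have ub: "is_lead (u * b) \<alpha>" "lookup (u * b) \<alpha> = lookup a \<alpha>"
    using is_lead_mult[OF u_lead b] lookup_mult_lead[OF u_lead b] nz sum
    by (auto simp: u_def)
  fix \<alpha>' assume "is_lead (a - u * b) \<alpha>'"
  then have "\<alpha>' \<in> keys (a - u * b)" by (simp add: is_lead_def)
  then have "\<alpha>' \<in> keys a \<or> \<alpha>' \<in> keys (u * b)" "\<alpha>' \<noteq> \<alpha>"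
    using ub(2) by (auto simp: in_keys_iff lookup_minus)
  then show "mon_less \<alpha>' \<alpha>" using a ub(1) by (auto simp: is_lead_def)
qed

text \<open>Complete integral closedness: a fraction a/b all of whose powers have the common
  denominator \<open>c\<close> is a polynomial. Induction on the leading monomial of
  \<open>a\<close>: large powers force the leading monomial of \<open>b\<close> to divide it, and a
  reduction step preserves the hypothesis.\<close>

lemma dvd_of_power_dvd:
  fixes a b c :: "('v::finite, 'k::field) mpoly"
  assumes "c \<noteq> 0" "b \<noteq> 0" "\<And>k. b ^ k dvd c * a ^ k"
  shows "b dvd a"
proof -
  obtain \<beta> where \<beta>: "is_lead b \<beta>" using ex_is_lead assms(2) by blast
  obtain \<gamma> where \<gamma>: "is_lead c \<gamma>" using ex_is_lead assms(1) by blast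
  have "b dvd a" if "\<And>k. b ^ k dvd c * a ^ k" "is_lead a \<alpha>" for a \<alpha>
    using that
  proof (induction \<alpha> arbitrary: a rule: wfp_induct_rule[OF wfp_mon_less])
    case (1 \<alpha>)
    have le: "lookup \<beta> i \<le> lookup \<alpha> i" for i
    proof (rule ccontr)
      assume less: "\<not> ?thesis"
      \<comment> \<open>A deficit of at least \<open>k\<close> in the exponent of \<open>i\<close>
        cannot be made up by \<open>\<gamma>\<close>, whose exponent there is only
        \<open>k - 1\<close>.\<close>
      define k where "k = Suc (lookup \<gamma> i)"
      obtain q where q: "c * a ^ k = b ^ k * q" using 1(2)[of k] by (auto elim: dvdE)
      obtain \<alpha>' where \<alpha>': "is_lead (a ^ k) \<alpha>'" "\<And>i. lookup \<alpha>' i = k * lookup \<alpha> i"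
        using is_lead_power[OF 1(3)] by metis
      obtain \<beta>' where \<beta>': "is_lead (b ^ k) \<beta>'" "\<And>i. lookup \<beta>' i = k * lookup \<beta> i"
        using is_lead_power[OF \<beta>] by metis
      have "q \<noteq> 0" using is_lead_mult[OF \<gamma> \<alpha>'(1)] q by (auto simp: is_lead_def)
      then obtain \<delta> where \<delta>: "is_lead q \<delta>" using ex_is_lead by blast
      have "\<gamma> + \<alpha>' = \<beta>' + \<delta>"
        using is_lead_mult[OF \<gamma> \<alpha>'(1)] is_lead_mult[OF \<beta>'(1) \<delta>] q is_lead_unique by metis
      then have "lookup \<gamma> i + k * lookup \<alpha> i = k * lookup \<beta> i + lookup \<delta> i"
        using \<alpha>'(2) \<beta>'(2) by (metis lookup_add)
      moreover have "k * lookup \<beta> i \<ge> k * lookup \<alpha> i + k"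
        using less mult_le_mono2[of "Suc (lookup \<alpha> i)" "lookup \<beta> i" k] by auto
      ultimately show False by (simp add: k_def)
    qed
    obtain u where u: "\<And>\<alpha>'. is_lead (a - u * b) \<alpha>' \<Longrightarrow> mon_less \<alpha>' \<alpha>"
      using lead_reduction[OF 1(3) \<beta> le] by blast
    define a' where "a' = a - u * b"
    have "b dvd a'"
    proof (cases "a' = 0")
      case False
      then obtain \<alpha>' where \<alpha>': "is_lead a' \<alpha>'" using ex_is_lead by blast
      then have less: "mon_less \<alpha>' \<alpha>" using u by (simp add: a'_def)
      \<comment> \<open>The hypothesis passes to \<open>a'\<close>: in each term of the binomial
        expansion \<open>c * a ^ j\<close> supplies the factor \<open>b ^ j\<close> and the power of
        \<open>u * b\<close> supplies the rest.\<close>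
      have "b ^ k dvd c * a' ^ k" for k
      proof -
        have "c * a' ^ k = (\<Sum>j\<le>k. of_nat (k choose j) * (c * a ^ j) * (- u * b) ^ (k - j))"
          unfolding a'_def using binomial_ring[of a "- u * b" k]
          by (simp add: sum_distrib_left algebra_simps)
        moreover have "b ^ k dvd of_nat (k choose j) * (c * a ^ j) * (- u * b) ^ (k - j)"
          if "j \<le> k" for j
        proof -
          have "b ^ j * b ^ (k - j) dvd (of_nat (k choose j) * (c * a ^ j)) * (- u * b) ^ (k - j)"
            by (rule mult_dvd_mono[OF dvd_mult[OF 1(2)] dvd_power_same[OF dvd_triv_right]])
          then show ?thesis using that by (simp flip: power_add)
        qed
        ultimately show ?thesis by (auto intro: dvd_sum)
      qed
      then show ?thesis using 1(1)[OF less _ \<alpha>'] by blast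
    qed auto
    moreover have "a = a' + u * b" by (simp add: a'_def)
    ultimately show ?case by (metis dvd_add dvd_triv_right)
  qed
  then show ?thesis using assms(3) ex_is_lead[of a] by (cases "a = 0") blast+
qed

section \<open>The Dedekind--Mertens content formula\<close>

text \<open>A ring as a module over itself, so that \<open>ring_mod.span\<close> is the generated
  ideal.\<close>

interpretation ring_mod: Modules.module "(*) :: 'a::comm_ring_1 \<Rightarrow> 'a \<Rightarrow> 'a"
  by unfold_locales (simp_all add: algebra_simps)

declare ring_mod.scale_scale [simp del] \<comment> \<open>loops with associativity of multiplication\<close>

text \<open>These products generate the \<open>n\<close>-th power of the ideal generated by
  \<open>X\<close>.\<close>

fun prods :: "'a::comm_ring_1 set \<Rightarrow> nat \<Rightarrow> 'a set" where
  "prods X 0 = {1}"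
| "prods X (Suc n) = {x * u | x u. x \<in> X \<and> u \<in> prods X n}"

lemma prods_mono: "X \<subseteq> Y \<Longrightarrow> prods X n \<subseteq> prods Y n"
  by (induction n) auto

lemma prods_Suc_I: "x \<in> X \<Longrightarrow> u \<in> prods X n \<Longrightarrow> x * u \<in> prods X (Suc n)"
  by auto

text \<open>\<open>X\<close> is \<open>Y\<close> with \<open>l\<close> possibly adjoined: a product
  either avoids \<open>l\<close>, or commutativity brings one factor \<open>l\<close> to the
  front.\<close>

lemma prods_split:
  assumes "X \<subseteq> insert l Y" "Y \<subseteq> X" "u \<in> prods X (Suc n)"
  shows "u \<in> prods Y (Suc n) \<or> (l \<in> X \<and> (\<exists>v\<in>prods X n. u = l * v))"
  using assms(3)
proof (induction n arbitrary: u)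
  case 0
  then show ?case using assms(1) by auto
next
  case (Suc n)
  obtain x w where u: "u = x * w" "x \<in> X" "w \<in> prods X (Suc n)"
    using Suc.prems by (subst (asm) prods.simps(2)) blast
  show ?case
  proof (cases "x = l")
    case True
    then show ?thesis using u by blast
  next
    case False
    then have "x \<in> Y" using u assms by blast
    from Suc.IH[OF u(3)] show ?thesis
    proof
      assume "w \<in> prods Y (Suc n)"
      then show ?thesis using prods_Suc_I[OF \<open>x \<in> Y\<close>] u by blast
    next
      assume "l \<in> X \<and> (\<exists>v\<in>prods X n. w = l * v)"
      then obtain v where "l \<in> X" "v \<in> prods X n" "w = l * v" by blast
      then show ?thesis using prods_Suc_I[OF u(2)] u by (metis mult.left_commute)
    qed
  qed
qed

lemma power_mem_prods: "x \<in> X \<Longrightarrow> x ^ n \<in> prods X n"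
  by (induction n) auto

declare prods.simps(2) [simp del]

definition coeff_set :: "'a::zero poly \<Rightarrow> 'a set" where
  "coeff_set f = range (coeff f)"

lemma coeff_in_coeff_set [simp]: "coeff f i \<in> coeff_set f"
  by (simp add: coeff_set_def)

text \<open>The ideal c(f)^m c(g), where c denotes the content ideal.\<close>

definition mixed_content :: "nat \<Rightarrow> 'a::comm_ring_1 poly \<Rightarrow> 'a poly \<Rightarrow> 'a set" where
  "mixed_content m f g = ring_mod.span {v * c | v c. v \<in> prods (coeff_set f) m \<and> c \<in> coeff_set g}"

lemma mixed_contentI: "v \<in> prods (coeff_set f) m \<Longrightarrow> v * coeff g i \<in> mixed_content m f g"
  unfolding mixed_content_def using coeff_in_coeff_set by (intro ring_mod.span_base) blast

lemma mixed_content_closed: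
  "x \<in> mixed_content m f g \<Longrightarrow> y \<in> mixed_content m f g \<Longrightarrow> x + y \<in> mixed_content m f g"
  "x \<in> mixed_content m f g \<Longrightarrow> y \<in> mixed_content m f g \<Longrightarrow> x - y \<in> mixed_content m f g"
  "x \<in> mixed_content m f g \<Longrightarrow> a * x \<in> mixed_content m f g"
  "0 \<in> mixed_content m f g"
  unfolding mixed_content_def
  by (auto intro: ring_mod.span_add ring_mod.span_diff ring_mod.span_scale ring_mod.span_zero)

lemma mixed_content_induct:
  assumes "x \<in> mixed_content m f g"
    and "\<And>v i. v \<in> prods (coeff_set f) m \<Longrightarrow> a * (v * coeff g i) \<in> mixed_content m' f' g'"
  shows "a * x \<in> mixed_content m' f' g'"
  using assms(1) unfolding mixed_content_def[of m f g]
proof (induction rule: ring_mod.span_induct_alt)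
  case base
  then show ?case by (simp add: mixed_content_closed)
next
  case (step c x y)
  then obtain v i where "x = v * coeff g i" "v \<in> prods (coeff_set f) m"
    by (auto simp: coeff_set_def)
  then have "c * (a * x) \<in> mixed_content m' f' g'" using assms(2) mixed_content_closed(3) by blast
  with step(2) mixed_content_closed(1) have "c * (a * x) + a * y \<in> mixed_content m' f' g'" by blast
  then show ?case by (simp add: algebra_simps)
qed

lemma degree_remove_lead:
  fixes f :: "'a::comm_ring_1 poly"
  assumes "degree f \<le> Suc n"
  shows "degree (f - monom (coeff f (Suc n)) (Suc n)) \<le> n"
  by (rule degree_le) (use assms in \<open>auto simp: coeff_eq_0\<close>)

lemma coeff_mult_top:
  fixes f h :: "'a::comm_ring_1 poly"
  assumes "degree f \<le> n" "degree h \<le> m"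
  shows "coeff (f * h) (n + m) = coeff f n * coeff h m"
proof -
  have "coeff (f * h) (n + m) = (\<Sum>i\<le>n+m. if i = n then coeff f n * coeff h m else 0)"
    unfolding coeff_mult
  proof (intro sum.cong refl)
    fix i assume "i \<in> {..n+m}"
    have "i > n \<Longrightarrow> coeff f i = 0" "i < n \<Longrightarrow> coeff h (n + m - i) = 0"
      using assms by (auto intro!: coeff_eq_0)
    then show "coeff f i * coeff h (n + m - i) = (if i = n then coeff f n * coeff h m else 0)"
      by (cases "i = n"; cases "i < n") auto
  qed
  then show ?thesis by simp
qed

text \<open>In terms of content ideals, c(f)^(m+1) c(h) is contained in c(f)^m c(fh). Outer
  induction on the bound for the degree of \<open>h\<close>, inner induction on that for
  \<open>f\<close>; both remove a top coefficient.\<close>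

lemma dedekind_mertens:
  fixes f h :: "'a::comm_ring_1 poly"
  assumes "degree f \<le> n" "degree h \<le> m" "u \<in> prods (coeff_set f) (Suc m)"
  shows "u * coeff h j \<in> mixed_content m f (f * h)"
  using assms
proof (induction m arbitrary: n f h u j)
  case 0
  then obtain i where u: "u = coeff f i" by (auto simp: coeff_set_def prods.simps(2))
  from 0 have h: "h = [:coeff h 0:]" by (metis degree_0_id le_zero_eq)
  have "coeff f i * coeff h 0 = 1 * coeff (f * h) i" by (subst (2) h) simp
  moreover have "1 * coeff (f * h) i \<in> mixed_content 0 f (f * h)" by (rule mixed_contentI) simp
  moreover have "j \<noteq> 0 \<Longrightarrow> coeff h j = 0" by (subst h) (simp add: coeff_pCons split: nat.splits)
  ultimately show ?case using u by (cases "j = 0") (auto simp: mixed_content_closed)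
next
  case (Suc m)
  note outer = Suc.IH
  from Suc.prems show ?case
  proof (induction n arbitrary: f u j)
    case 0
    then obtain i v where u: "u = coeff f i * v" "v \<in> prods (coeff_set f) (Suc m)"
      unfolding coeff_set_def by (subst (asm) prods.simps(2)) blast
    from 0 have f: "f = [:coeff f 0:]" by (metis degree_0_id le_zero_eq)
    have eq: "coeff f i * coeff h j = (if i = 0 then coeff (f * h) j else 0)"
      by (subst (1 2) f) (simp add: coeff_pCons split: nat.splits)
    have "u * coeff h j = v * (coeff f i * coeff h j)" by (simp only: u(1) mult_ac)
    then have "u * coeff h j = v * (if i = 0 then coeff (f * h) j else 0)" by (simp only: eq)
    then show ?case using mixed_contentI[OF u(2)] by (auto simp: mixed_content_closed)
  next
    case (Suc n)
    define l where "l = coeff f (Suc n)"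
    define b where "b = coeff h (Suc m)"
    define f' where "f' = f - monom l (Suc n)"
    define h' where "h' = h - monom b (Suc m)"
    have deg: "degree f' \<le> n" "degree h' \<le> m"
      unfolding f'_def h'_def l_def b_def using Suc.prems degree_remove_lead by blast+
    have lb: "l * b = coeff (f * h) (Suc n + Suc m)"
      unfolding l_def b_def using coeff_mult_top[of f "Suc n" h "Suc m"] Suc.prems(1,2) by simp
    have ls: "l \<in> coeff_set f" by (simp add: l_def)
    have fh': "f * h' = f * h - monom b (Suc m) * f" by (simp add: h'_def algebra_simps)
    have f'h: "f' * h = f * h - monom l (Suc n) * h" by (simp add: f'_def algebra_simps)
    let ?M = "mixed_content (Suc m) f (f * h)"
    \<comment> \<open>Products with a factor \<open>l\<close>: the top coefficient of
      \<open>h\<close> is covered by \<open>lb\<close>, the lower ones by the outer hypothesis for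
      \<open>f\<close> and \<open>h'\<close>.\<close>
    have A: "l * (v * coeff h j) \<in> ?M" if v: "v \<in> prods (coeff_set f) (Suc m)" for v j
    proof (cases "j = Suc m")
      case True
      then have "l * (v * coeff h j) = v * coeff (f * h) (Suc n + Suc m)"
        by (simp only: lb[symmetric] b_def mult_ac)
      then show ?thesis using mixed_contentI[OF v] by simp
    next
      case False
      then have "v * coeff h j = v * coeff h' j" by (simp add: h'_def)
      also have "\<dots> \<in> mixed_content m f (f * h')"
        using outer[OF Suc.prems(1) deg(2)] v by blast
      finally show ?thesis
      proof (rule mixed_content_induct)
        fix w i assume w: "w \<in> prods (coeff_set f) m"
        \<comment> \<open>Passing from \<open>h'\<close> back to \<open>h\<close> costs a multiple
          of \<open>l * b\<close>, which is itself a coefficient of \<open>f * h\<close>.\<close>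
        have "l * (w * coeff (f * h') i)
            = (l * w) * coeff (f * h) i
              - (if i < Suc m then 0 else (coeff f (i - Suc m) * w) * coeff (f * h) (Suc n + Suc m))"
          by (simp only: lb[symmetric] fh' coeff_diff coeff_monom_mult)
            (simp add: algebra_simps)
        also have "\<dots> \<in> ?M"
          using mixed_contentI[where g = "f * h", OF prods_Suc_I[OF ls w]]
            mixed_contentI[where g = "f * h", OF prods_Suc_I[OF coeff_in_coeff_set w]]
          by (intro mixed_content_closed(2)) (auto simp: mixed_content_closed(4))
        finally show "l * (w * coeff (f * h') i) \<in> ?M" .
      qed
    qed
    have sub: "coeff_set f' \<subseteq> coeff_set f" "coeff_set f \<subseteq> insert l (coeff_set f')"
    proof -
      \<comment> \<open>Truncation puts a 0 in place of \<open>l\<close>, and 0 is a coefficient of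
        \<open>f\<close> beyond its degree.\<close>
      have "coeff f (Suc (degree f)) = 0" by (simp add: coeff_eq_0)
      then have "0 \<in> coeff_set f" by (metis coeff_in_coeff_set)
      moreover have c: "coeff f' i = (if i = Suc n then 0 else coeff f i)" for i
        by (simp add: f'_def l_def)
      ultimately show "coeff_set f' \<subseteq> coeff_set f" by (auto simp: coeff_set_def)
      show "coeff_set f \<subseteq> insert l (coeff_set f')"
      proof
        fix x assume "x \<in> coeff_set f"
        then obtain i where "x = coeff f i" by (auto simp: coeff_set_def)
        then show "x \<in> insert l (coeff_set f')"
          using c[of i] coeff_in_coeff_set[of f' i] by (cases "i = Suc n") (auto simp: l_def)
      qed
    qed
    from prods_split[OF sub(2,1) Suc.prems(3)] show ?case
    proof
      \<comment> \<open>Products avoiding \<open>l\<close>: the inner hypothesis applies to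
        \<open>f'\<close>, and \<open>f' * h\<close> differs from \<open>f * h\<close> by a shift of
        \<open>l\<close> times \<open>h\<close>, which is covered by \<open>A\<close>.\<close>
      assume "u \<in> prods (coeff_set f') (Suc (Suc m))"
      then have "u * coeff h j \<in> mixed_content (Suc m) f' (f' * h)"
        using Suc.IH[OF deg(1) Suc.prems(2)] by blast
      then have "1 * (u * coeff h j) \<in> ?M"
      proof (rule mixed_content_induct)
        fix w i assume "w \<in> prods (coeff_set f') (Suc m)"
        then have w: "w \<in> prods (coeff_set f) (Suc m)" using prods_mono[OF sub(1)] by blast
        have "1 * (w * coeff (f' * h) i)
          = w * coeff (f * h) i - (if i < Suc n then 0 else l * (w * coeff h (i - Suc n)))"
          by (simp only: f'h coeff_diff coeff_monom_mult) (simp add: algebra_simps)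
        also have "\<dots> \<in> ?M"
          using mixed_contentI[where g = "f * h", OF w] A[OF w]
          by (intro mixed_content_closed(2)) (auto simp: mixed_content_closed(4))
        finally show "1 * (w * coeff (f' * h) i) \<in> ?M" .
      qed
      then show ?case by simp
    next
      assume "l \<in> coeff_set f \<and> (\<exists>v\<in>prods (coeff_set f) (Suc m). u = l * v)"
      then show ?case using A by (auto simp: mult.assoc)
    qed
  qed
qed

text \<open>Each quotient of a coefficient of \<open>P\<close> by the leading one maps a power of
  the content ideal of \<open>H\<close> into itself; it is therefore almost integral, hence a
  polynomial.\<close>

lemma lead_coeff_dvd_of_smult_monic_eq_mult:
  fixes G P H :: "('v::finite, 'k::field) mpoly poly"
  assumes eq: "smult a G = P * H" and G: "lead_coeff G = 1" and a: "a \<noteq> 0"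
  shows "lead_coeff P dvd coeff P j"
proof -
  define p where "p = lead_coeff P"
  define l where "l = lead_coeff H"
  have "smult a G \<noteq> 0"
  proof
    assume "smult a G = 0"
    then have "coeff (smult a G) (degree G) = 0" by simp
    then show False using G a by simp
  qed
  then have "P \<noteq> 0" "H \<noteq> 0" using eq by auto
  then have nz: "p \<noteq> 0" "l \<noteq> 0" by (auto simp: p_def l_def)
  have "coeff (P * H) (degree P + degree H) = p * l"
    by (simp add: coeff_mult_degree_sum p_def l_def)
  then have top: "a * coeff G (degree P + degree H) = p * l" using eq by (metis coeff_smult)
  \<comment> \<open>Leading coefficients do not multiply to zero, so degrees in T add and
    \<open>a\<close> is the product of the two leading coefficients.\<close>
  have "degree G = degree P + degree H"
  proof (rule antisym)
    have "coeff (P * H) (degree G) = a" using eq[symmetric] G by simp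
    then have "coeff (P * H) (degree G) \<noteq> 0" using a by simp
    then have "degree G \<le> degree (P * H)" by (rule le_degree)
    then show "degree G \<le> degree P + degree H" using degree_mult_le order_trans by blast
    have "coeff G (degree P + degree H) \<noteq> 0"
      using top nz mpoly_mult_nonzero by (metis mult_zero_right)
    then show "degree P + degree H \<le> degree G" by (rule le_degree)
  qed
  with top G have al: "a = l * p" by (simp add: mult.commute)
  define m where "m = degree P"
  let ?C = "ring_mod.span (prods (coeff_set H) m)"
  \<comment> \<open>Multiplication by \<open>coeff P j\<close> maps \<open>?C\<close> into
    \<open>p\<close> times \<open>?C\<close>: by Dedekind--Mertens, \<open>l * v * coeff P j\<close>
    lies in \<open>a\<close> times \<open>?C\<close>, where \<open>a = l * p\<close>, and
    \<open>l\<close> cancels.\<close>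
  have step: "\<exists>w\<in>?C. v * coeff P j = p * w" if "v \<in> ?C" for v
    using that
  proof (induction rule: ring_mod.span_induct_alt)
    case base
    then show ?case by (auto intro!: bexI[of _ 0] ring_mod.span_zero)
  next
    case (step c v y)
    have "l * v \<in> prods (coeff_set H) (Suc m)"
      by (rule prods_Suc_I) (use step in \<open>auto simp: l_def\<close>)
    then have "(l * v) * coeff P j \<in> mixed_content m H (H * P)"
      by (intro dedekind_mertens[of H "degree H"]) (auto simp: m_def)
    also have "H * P = smult a G" using eq by (simp add: mult.commute)
    also have "mixed_content m H (smult a G) \<subseteq> {a * w | w. w \<in> ?C}"
    proof -
      have "\<exists>w\<in>?C. x = a * w" if "x \<in> mixed_content m H (smult a G)" for x
        using that unfolding mixed_content_def
      proof (induction rule: ring_mod.span_induct_alt)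
        case base
        then show ?case by (auto intro!: bexI[of _ 0] ring_mod.span_zero)
      next
        case (step c x y)
        then obtain w v i where "w \<in> ?C" "y = a * w" "v \<in> prods (coeff_set H) m"
            "x = v * (a * coeff G i)"
          by (auto simp: coeff_set_def)
        moreover from this(2,4) have "c * x + y = a * ((c * coeff G i) * v + w)"
          by (simp only: distrib_left mult_ac)
        moreover from calculation have "(c * coeff G i) * v + w \<in> ?C"
          by (intro ring_mod.span_add ring_mod.span_scale[of v]) (rule ring_mod.span_base)
        ultimately show ?case by blast
      qed
      then show ?thesis by blast
    qed
    finally obtain w where w: "w \<in> ?C" "l * v * coeff P j = a * w" by blast
    then have "l * (v * coeff P j) = l * (p * w)" by (simp add: al mult.assoc)
    then have "v * coeff P j = p * w" using mpoly_mult_left_cancel[OF nz(2)] by blast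
    moreover obtain w' where "w' \<in> ?C" "y * coeff P j = p * w'" using step by blast
    moreover from calculation have "(c * v + y) * coeff P j = p * (c * w + w')"
      by (simp only: distrib_left distrib_right mult.assoc mult.left_commute[of p])
    moreover from calculation w(1) have "c * w + w' \<in> ?C"
      by (intro ring_mod.span_add ring_mod.span_scale)
    ultimately show ?case by blast
  qed
  \<comment> \<open>Iteration starting from \<open>l ^ m\<close> in \<open>?C\<close>; this element
    serves as common denominator for all powers.\<close>
  have "\<exists>w\<in>?C. l ^ m * coeff P j ^ k = p ^ k * w" for k
  proof (induction k)
    case 0
    have "l ^ m \<in> ?C" by (intro ring_mod.span_base power_mem_prods) (simp add: l_def)
    then show ?case by auto
  next
    case (Suc k)
    then obtain w where w: "w \<in> ?C" "l ^ m * coeff P j ^ k = p ^ k * w" by blast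
    obtain w' where w': "w' \<in> ?C" "w * coeff P j = p * w'" using step[OF w(1)] by blast
    have "l ^ m * coeff P j ^ Suc k = (l ^ m * coeff P j ^ k) * coeff P j"
      by (simp add: algebra_simps)
    also have "\<dots> = p ^ k * (w * coeff P j)" by (simp add: w(2) mult.assoc)
    also have "\<dots> = p ^ Suc k * w'" by (simp add: w'(2) mult_ac)
    finally show ?case using w' by blast
  qed
  then have "p ^ k dvd l ^ m * coeff P j ^ k" for k by (metis dvdI)
  then show ?thesis
    using dvd_of_power_dvd[OF mpoly_power_nonzero[OF nz(2)] nz(1)] by (metis p_def)
qed

section \<open>Finite ring homomorphisms\<close>

text \<open>The ring is a finitely generated module over itself with scalars acting through
  \<open>\<phi>\<close>; the image of \<open>\<phi>\<close> need not be made a ring type.\<close>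

definition finite_hom :: "('a::comm_ring_1 \<Rightarrow> 'a) \<Rightarrow> bool" where
  "finite_hom \<phi> \<longleftrightarrow> (\<exists>S. finite S \<and> Modules.module.span (\<lambda>a b. \<phi> a * b) S = UNIV)"

lemma (in comm_ring_hom) module_hom_scale: "Modules.module (\<lambda>a b. hom a * b)"
  by unfold_locales (simp_all add: hom_distribs algebra_simps)

lemma comm_ring_hom_compose:
  assumes "comm_ring_hom \<phi>" "comm_ring_hom \<psi>"
  shows "comm_ring_hom (\<phi> \<circ> \<psi>)"
proof -
  interpret p: comm_ring_hom \<phi> by fact
  interpret q: comm_ring_hom \<psi> by fact
  show ?thesis by unfold_locales (simp_all add: hom_distribs)
qed

text \<open>Tower law: the generators are products of those for \<open>\<phi>\<close> with the
  images under \<open>\<phi>\<close> of those for \<open>\<psi>\<close>.\<close>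

lemma finite_hom_compose:
  fixes \<phi> \<psi> :: "'a::comm_ring_1 \<Rightarrow> 'a"
  assumes "comm_ring_hom \<phi>" "comm_ring_hom \<psi>" "finite_hom \<phi>" "finite_hom \<psi>"
  shows "finite_hom (\<phi> \<circ> \<psi>)"
proof -
  interpret p: comm_ring_hom \<phi> by fact
  interpret q: comm_ring_hom \<psi> by fact
  interpret pq: comm_ring_hom "\<phi> \<circ> \<psi>" by (rule comm_ring_hom_compose) fact+
  interpret P: Modules.module "\<lambda>a b. \<phi> a * b" by (rule p.module_hom_scale)
  interpret Q: Modules.module "\<lambda>a b. \<psi> a * b" by (rule q.module_hom_scale)
  interpret R: Modules.module "\<lambda>a b. \<phi> (\<psi> a) * b"
    by (rule pq.module_hom_scale[unfolded comp_apply])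
  obtain S where S: "finite S" "P.span S = UNIV" using assms by (auto simp: finite_hom_def)
  obtain S' where S': "finite S'" "Q.span S' = UNIV" using assms by (auto simp: finite_hom_def)
  define T where "T = (\<lambda>(s, s'). \<phi> s' * s) ` (S \<times> S')"
  have inner: "\<phi> c * s \<in> R.span T" if s: "s \<in> S" for c s
  proof -
    have "c \<in> Q.span S'" using S' by simp
    then show ?thesis
    proof (induction rule: Q.span_induct_alt)
      case base
      then show ?case by (simp add: R.span_zero)
    next
      case (step d s' z)
      have "\<phi> (\<psi> d) * (\<phi> s' * s) \<in> R.span T"
        using s step by (intro R.span_scale R.span_base) (auto simp: T_def)
      from R.span_add[OF this step(2)] show ?case by (simp add: hom_distribs algebra_simps)
    qed
  qed
  have "b \<in> R.span T" for b
  proof -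
    have "b \<in> P.span S" using S by simp
    then show ?thesis
    proof (induction rule: P.span_induct_alt)
      case base
      then show ?case by (simp add: R.span_zero)
    next
      case (step c s y)
      then show ?case using inner by (intro R.span_add) auto
    qed
  qed
  moreover have "finite T" using S S' by (simp add: T_def)
  ultimately show ?thesis unfolding finite_hom_def comp_apply by blast
qed

lemma comm_ring_hom_funpow:
  fixes \<phi> :: "'a::comm_ring_1 \<Rightarrow> 'a"
  assumes "comm_ring_hom \<phi>"
  shows "comm_ring_hom (\<phi> ^^ k)"
proof (induction k)
  case 0
  show ?case by unfold_locales auto
next
  case (Suc k)
  then show ?case using comm_ring_hom_compose[OF assms] by (simp only: funpow.simps)
qed

text \<open>Makes integrality available over the image of every iterate, as the study of the chain
  of kernels requires.\<close>

lemma finite_hom_funpow: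
  fixes \<phi> :: "'a::comm_ring_1 \<Rightarrow> 'a"
  assumes "comm_ring_hom \<phi>" "finite_hom \<phi>"
  shows "finite_hom (\<phi> ^^ k)"
proof (induction k)
  case 0
  have "b \<in> ring_mod.span {1}" for b :: 'a
    using ring_mod.span_scale[OF ring_mod.span_base, of 1 "{1}" b] by simp
  then have "ring_mod.span {1 :: 'a} = UNIV" by blast
  then show ?case unfolding finite_hom_def by (intro exI[of _ "{1}"]) simp
next
  case (Suc k)
  then show ?case
    using finite_hom_compose[OF assms(1) comm_ring_hom_funpow[OF assms(1)] assms(2)]
    by (simp only: funpow.simps)
qed

text \<open>Determinant trick: multiplication by \<open>b\<close> acts on the generators by a matrix
  with entries in the image of \<open>\<phi>\<close>, and its characteristic polynomial is the image
  of one over the source.\<close>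

lemma integral_of_finite_hom:
  fixes \<phi> :: "'a::comm_ring_1 \<Rightarrow> 'a"
  assumes "comm_ring_hom \<phi>" "finite_hom \<phi>"
  shows "\<exists>F. lead_coeff F = 1 \<and> (\<forall>j. coeff F j \<in> range \<phi>) \<and> poly F b = 0"
proof -
  interpret comm_ring_hom \<phi> by fact
  interpret P: Modules.module "\<lambda>a b. \<phi> a * b" by (rule module_hom_scale)
  obtain S where S: "finite S" "P.span S = UNIV" using assms by (auto simp: finite_hom_def)
  obtain xs where xs: "set xs = S" "distinct xs" using finite_distinct_list[OF S(1)] by blast
  define n where "n = length xs"
  have repr: "\<exists>c. y = (\<Sum>j<n. \<phi> (c j) * xs ! j)" for y
  proof -
    have "y \<in> P.span S" using S by simp
    then obtain u where "y = (\<Sum>s\<in>S. \<phi> (u s) * s)" unfolding P.span_finite[OF S(1)] by blast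
    also have "\<dots> = (\<Sum>j<n. \<phi> (u (xs ! j)) * xs ! j)"
      by (rule sum.reindex_bij_betw[symmetric]) (use bij_betw_nth[OF xs(2) refl] xs(1) in
        \<open>simp add: n_def lessThan_def\<close>)
    finally show ?thesis by (intro exI[of _ "\<lambda>j. u (xs ! j)"])
  qed
  have "\<forall>i. \<exists>c. b * xs ! i = (\<Sum>j<n. \<phi> (c j) * xs ! j)" using repr by blast
  then obtain c where c: "\<And>i. b * xs ! i = (\<Sum>j<n. \<phi> (c i j) * xs ! j)" by metis
  define M where "M = mat n n (\<lambda>(i, j). c i j)"
  have M: "M \<in> carrier_mat n n" "map_mat \<phi> M \<in> carrier_mat n n" by (auto simp: M_def)
  define F where "F = char_poly (map_mat \<phi> M)"
  have F: "F = map_poly \<phi> (char_poly M)" unfolding F_def by (rule char_poly_hom[OF M(1)])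
  define X where "X = mat n n (\<lambda>(i, j). (if i = j then b else 0) - \<phi> (c i j))"
  have X: "X \<in> carrier_mat n n" by (simp add: X_def)
  have pF: "poly F b = det X"
    unfolding F_def char_poly_def
    by (rule poly_det_cong[of _ n]) (auto simp: char_poly_matrix_def X_def M_def)
  define v where "v = vec n (\<lambda>i. xs ! i)"
  have v: "v \<in> carrier_vec n" by (simp add: v_def)
  have "X *\<^sub>v v = 0\<^sub>v n"
  proof (rule eq_vecI)
    fix i assume "i < dim_vec (0\<^sub>v n :: 'a vec)"
    then have i: "i < n" by simp
    then have "(X *\<^sub>v v) $ i = (\<Sum>j<n. ((if i = j then b else 0) - \<phi> (c i j)) * xs ! j)"
      by (simp add: X_def v_def scalar_prod_def lessThan_atLeast0)
    also have "\<dots> = (\<Sum>j<n. if i = j then b * xs ! j else 0) - (\<Sum>j<n. \<phi> (c i j) * xs ! j)"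
      unfolding sum_subtractf[symmetric] by (intro sum.cong) (auto simp: algebra_simps)
    also have "\<dots> = 0" using i c[of i] by simp
    finally show "(X *\<^sub>v v) $ i = 0\<^sub>v n $ i" using i by simp
  qed (use X in auto)
  \<comment> \<open>Multiplication by the adjugate shows that \<open>det X\<close> annihilates every
    generator.\<close>
  then have "(adj_mat X * X) *\<^sub>v v = 0\<^sub>v n"
    using assoc_mult_mat_vec[OF adj_mat(1)[OF X] X v] adj_mat(1)[OF X] by (auto intro!: eq_vecI)
  then have "(det X \<cdot>\<^sub>m 1\<^sub>m n) *\<^sub>v v = 0\<^sub>v n" by (simp add: adj_mat(3)[OF X])
  then have dv: "det X * xs ! i = 0" if i: "i < n" for i
  proof -
    have "((det X \<cdot>\<^sub>m 1\<^sub>m n) *\<^sub>v v) $ i = (\<Sum>j=0..<n. det X * (if j = i then 1 else 0) * xs ! j)"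
      using i by (simp add: v_def scalar_prod_def)
    also have "\<dots> = (\<Sum>j=0..<n. if j = i then det X * xs ! j else 0)" by (rule sum.cong) auto
    finally show ?thesis using i \<open>(det X \<cdot>\<^sub>m 1\<^sub>m n) *\<^sub>v v = 0\<^sub>v n\<close> by simp
  qed
  \<comment> \<open>As 1 is a combination of the generators, a determinant annihilating all of them
    is zero.\<close>
  obtain d where "1 = (\<Sum>j<n. \<phi> (d j) * xs ! j)" using repr by blast
  then have "det X = det X * (\<Sum>j<n. \<phi> (d j) * xs ! j)" by simp
  also have "\<dots> = (\<Sum>j<n. \<phi> (d j) * (det X * xs ! j))"
    by (simp add: sum_distrib_left algebra_simps)
  also have "\<dots> = 0" using dv by simp
  finally have "poly F b = 0" by (simp add: pF)
  moreover have "lead_coeff F = 1" using degree_monic_char_poly[OF M(2)] by (simp add: F_def)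
  moreover have "coeff F j \<in> range \<phi>" for j by (simp add: F)
  ultimately show ?thesis by blast
qed

section \<open>From equations for the variables to finite generation by monomials\<close>

lemma mon_induct [case_names zero step]:
  fixes a :: "'v::finite \<Rightarrow>\<^sub>0 nat"
  assumes "P 0" "\<And>i a. P a \<Longrightarrow> P (single i 1 + a)"
  shows "P a"
proof (induction "mon_deg a" arbitrary: a)
  case 0
  then have "a = 0" by (intro poly_mapping_eqI) (simp add: mon_deg_eq_sum)
  then show ?case using assms by simp
next
  case (Suc n)
  then have "\<exists>i. lookup a i \<noteq> 0" by (metis mon_deg_eq_sum nat.distinct(1) sum.neutral)
  then obtain i where i: "lookup a i \<noteq> 0" by blast
  have eq: "a = single i 1 + (a - single i 1)"
    by (rule poly_mapping_eqI) (use i in \<open>auto simp: lookup_add lookup_minus lookup_single when_def\<close>)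
  then have "mon_deg a = 1 + mon_deg (a - single i 1)" by (metis mon_deg_add mon_deg_single)
  then have "P (a - single i 1)" using Suc by simp
  then show ?case using assms(2) eq by metis
qed

lemma mvar_power: "(mvar i :: ('v, 'k::comm_ring_1) mpoly) ^ j = single (single i j) 1"
  by (induction j) (simp_all add: mvar_def mult_single single_add[symmetric])

lemma finite_mon_box: "finite {a :: 'v::finite \<Rightarrow>\<^sub>0 nat. \<forall>i. lookup a i < N i}"
proof (rule finite_imageD)
  have "lookup ` {a :: 'v \<Rightarrow>\<^sub>0 nat. \<forall>i. lookup a i < N i} \<subseteq> (\<Pi>\<^sub>E i\<in>UNIV. {..<N i})" by auto
  then show "finite (lookup ` {a :: 'v \<Rightarrow>\<^sub>0 nat. \<forall>i. lookup a i < N i})"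
    by (rule finite_subset) (auto intro: finite_PiE)
  show "inj_on lookup {a :: 'v \<Rightarrow>\<^sub>0 nat. \<forall>i. lookup a i < N i}"
    by (auto intro: inj_onI poly_mapping_eqI)
qed

lemma is_K_alg_homD:
  assumes "is_K_alg_hom \<phi>"
  shows "comm_ring_hom \<phi>" "\<phi> (mconst c) = mconst c"
proof -
  have "\<phi> 0 + \<phi> 0 = \<phi> 0" using assms unfolding is_K_alg_hom_def by (metis add_0)
  then have "\<phi> 0 = 0" by simp
  then show "comm_ring_hom \<phi>" using assms unfolding is_K_alg_hom_def by unfold_locales auto
  show "\<phi> (mconst c) = mconst c" using assms unfolding is_K_alg_hom_def by simp
qed

text \<open>The monomials whose exponent of each \<open>i\<close> is below the degree of the
  equation of \<open>mvar i\<close> generate: their span is stable under multiplication by every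
  variable.\<close>

lemma finite_hom_of_integral_vars:
  fixes \<phi> :: "('v::finite, 'k::field) mpoly \<Rightarrow> ('v, 'k) mpoly"
  assumes \<phi>: "is_K_alg_hom \<phi>"
    and F: "\<And>i. \<exists>F. lead_coeff F = 1 \<and> (\<forall>j. coeff F j \<in> range \<phi>) \<and> poly F (mvar i) = 0"
  shows "finite_hom \<phi>"
proof -
  interpret comm_ring_hom \<phi> by (rule is_K_alg_homD[OF \<phi>])
  interpret P: Modules.module "\<lambda>a b. \<phi> a * b" by (rule module_hom_scale)
  obtain F where F: "\<And>i. lead_coeff (F i) = 1" "\<And>i j. coeff (F i) j \<in> range \<phi>"
      "\<And>i. poly (F i) (mvar i) = 0"
    using F by metis
  define N where "N i = degree (F i)" for i
  \<comment> \<open>A monic constant has no root. Hence the exponent 0 is always allowed and the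
    monomial 1 lies in \<open>S\<close>.\<close>
  have N: "N i > 0" for i
  proof (rule ccontr)
    assume "\<not> N i > 0"
    then have "F i = [:lead_coeff (F i):]" using degree_0_id[of "F i"] by (simp add: N_def)
    then have "poly (F i) (mvar i) = 1" using F(1) by (metis poly_const_conv)
    then show False using F(3) by simp
  qed
  define S :: "('v, 'k) mpoly set" where "S = (\<lambda>a. single a 1) ` {a. \<forall>i. lookup a i < N i}"
  have finS: "finite S" unfolding S_def using finite_mon_box by blast
  \<comment> \<open>A monomial leaves the box only when the exponent of \<open>i\<close> reaches
    \<open>N i\<close>; the monic equation then rewrites \<open>mvar i ^ N i\<close> by lower
    powers.\<close>
  have mult: "mvar i * single a 1 \<in> P.span S" if a: "\<forall>i. lookup a i < N i" for i a
  proof -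
    define a' where "a' = a - single i (lookup a i)"
    have a': "lookup a' k = (if k = i then 0 else lookup a k)" for k
      by (auto simp: a'_def lookup_minus lookup_single when_def)
    have aa': "a = single i (lookup a i) + a'"
      by (rule poly_mapping_eqI) (auto simp: a' lookup_add lookup_single when_def)
    have box: "mvar i ^ j * single a' 1 \<in> S" if "j < N i" for j
      unfolding S_def mvar_power mult_single using that a
      by (intro image_eqI[of _ _ "single i j + a'"]) (auto simp: a' lookup_add lookup_single when_def)
    have "single a 1 = mvar i ^ lookup a i * single a' (1 :: 'k)"
      by (simp only: mvar_power mult_single aa'[symmetric] mult_1)
    then have eq: "mvar i * single a 1 = mvar i ^ Suc (lookup a i) * single a' (1 :: 'k)"
      by (simp add: mult.assoc)
    show ?thesis
    proof (cases "Suc (lookup a i) < N i")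
      case True
      then show ?thesis unfolding eq by (intro P.span_base box)
    next
      case False
      then have Suc: "Suc (lookup a i) = N i" using a by (metis Suc_lessI)
      have "0 = (\<Sum>j\<le>N i. coeff (F i) j * mvar i ^ j)" using F(3)[of i] by (simp add: poly_altdef N_def)
      also have "\<dots> = (\<Sum>j<N i. coeff (F i) j * mvar i ^ j) + mvar i ^ N i"
        using F(1)[of i] by (simp add: N_def lessThan_Suc_atMost[symmetric])
      finally have "mvar i ^ N i = - (\<Sum>j<N i. coeff (F i) j * mvar i ^ j)"
        by (metis add.commute minus_unique)
      then have "mvar i * single a 1 = - (\<Sum>j<N i. coeff (F i) j * (mvar i ^ j * single a' 1))"
        unfolding eq Suc by (simp add: sum_distrib_right mult.assoc)
      also have "\<dots> \<in> P.span S"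
      proof (intro P.span_neg P.span_sum)
        fix j assume "j \<in> {..<N i}"
        moreover obtain c where "coeff (F i) j = \<phi> c" using F(2) by blast
        ultimately show "coeff (F i) j * (mvar i ^ j * single a' 1) \<in> P.span S"
          using P.span_scale[OF P.span_base[OF box], of j c] by simp
      qed
      finally show ?thesis .
    qed
  qed
  have mult_span: "mvar i * p \<in> P.span S" if "p \<in> P.span S" for p i
    using that
  proof (induction rule: P.span_induct_alt)
    case base
    then show ?case by (simp add: P.span_zero)
  next
    case (step c x y)
    then have "mvar i * x \<in> P.span S" using mult by (auto simp: S_def)
    from P.span_add[OF P.span_scale[OF this, of c] step(2)] show ?case
      by (simp add: algebra_simps)
  qed
  have mon: "single a 1 \<in> P.span S" for a
  proof (induction a rule: mon_induct)
    case zero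
    show ?case using N by (intro P.span_base) (auto simp: S_def intro!: image_eqI[of _ _ 0])
  next
    case (step i a)
    from mult_span[OF this, of i] show ?case by (simp add: mvar_def mult_single)
  qed
  have "p \<in> P.span S" for p
  proof -
    \<comment> \<open>Constants are fixed by \<open>\<phi>\<close>, so they act as scalars.\<close>
    have "single a c \<in> P.span S" for a c
      using P.span_scale[OF mon, of "mconst c" a] is_K_alg_homD(2)[OF \<phi>]
      by (simp add: mconst_def mult_single)
    then have "(\<Sum>a\<in>keys p. single a (lookup p a)) \<in> P.span S" by (intro P.span_sum)
    then show ?thesis by (simp add: sum_monomials)
  qed
  then show ?thesis unfolding finite_hom_def using finS by blast
qed

section \<open>Integral homomorphisms are injective\<close>

lemma nat_seq_incseq_subseq:
  fixes s :: "nat \<Rightarrow> nat"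
  shows "\<exists>f. strict_mono f \<and> incseq (s \<circ> f)"
proof -
  obtain f where f: "strict_mono f" "monoseq (\<lambda>n. s (f n))" using seq_monosub by blast
  show ?thesis
  proof (cases "incseq (s \<circ> f)")
    case True
    then show ?thesis using f by blast
  next
    case False
    then have dec: "decseq (s \<circ> f)" using f(2) by (auto simp: monoseq_iff o_def)
    \<comment> \<open>A nonincreasing sequence of naturals is constant from the place where it
      attains its minimum.\<close>
    obtain n where n: "\<And>m. (s \<circ> f) n \<le> (s \<circ> f) m"
      using ex_has_least_nat[of "\<lambda>_. True" 0 "s \<circ> f"] by blast
    have "(s \<circ> f) (n + m) = (s \<circ> f) n" for m
      using n[of "n + m"] decseqD[OF dec, of n "n + m"] by simp
    then have "incseq (s \<circ> (\<lambda>m. f (n + m)))" by (simp add: incseq_def)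
    moreover have "strict_mono (\<lambda>m. f (n + m))" using f(1) by (simp add: strict_mono_def)
    ultimately show ?thesis by blast
  qed
qed

text \<open>Passing to subsequences one variable at a time makes every exponent nondecreasing; the
  first two members then serve.\<close>

lemma dickson:
  fixes r :: "nat \<Rightarrow> ('v::finite \<Rightarrow>\<^sub>0 nat)"
  shows "\<exists>i j. i < j \<and> (\<forall>v. lookup (r i) v \<le> lookup (r j) v)"
proof -
  have "\<exists>f. strict_mono f \<and> (\<forall>v\<in>V. incseq (\<lambda>k. lookup (r (f k)) v))" if "finite V" for V
    using that
  proof induction
    case empty
    show ?case by (auto intro: strict_mono_id)
  next
    case (insert v V)
    then obtain f where f: "strict_mono f" "\<forall>v\<in>V. incseq (\<lambda>k. lookup (r (f k)) v)" by blast
    obtain g where g: "strict_mono g" "incseq ((\<lambda>k. lookup (r (f k)) v) \<circ> g)"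
      using nat_seq_incseq_subseq by blast
    have "strict_mono (f \<circ> g)" using f g by (simp add: strict_mono_o)
    moreover have "incseq (\<lambda>k. lookup (r ((f \<circ> g) k)) w)" if "w \<in> insert v V" for w
      using that f g by (auto simp: incseq_def o_def dest: strict_mono_leD)
    ultimately show ?case by blast
  qed
  then obtain f where f: "strict_mono f" "\<And>v. incseq (\<lambda>k. lookup (r (f k)) v)"
    by (metis finite UNIV_I)
  then have "f 0 < f 1" "\<forall>v. lookup (r (f 0)) v \<le> lookup (r (f 1)) v"
    by (auto simp: strict_mono_def incseq_def)
  then show ?thesis by blast
qed

text \<open>In a domain \<open>q\<close> can be cancelled from the equation until the constant term
  is nonzero; that term is then a multiple of \<open>q\<close>. Being monic, the polynomial cannot
  be exhausted first.\<close>

lemma integral_dvd_constant: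
  fixes q :: "('v::finite, 'k::field) mpoly"
  assumes "q \<noteq> 0" "lead_coeff F = 1" "\<And>j. coeff F j \<in> A" "poly F q = 0"
  shows "\<exists>c\<in>A. c \<noteq> 0 \<and> q dvd c"
  using assms(2-)
proof (induction F)
  case 0
  then show ?case by simp
next
  case (pCons a F)
  have eq: "a + q * poly F q = 0" using pCons.prems by simp
  show ?case
  proof (cases "a = 0")
    case True
    then have "poly F q = 0" using eq assms(1) by (simp add: mpoly_mult_eq_0)
    moreover have "F \<noteq> 0" using pCons.hyps True by simp
    then have "lead_coeff F = 1" using pCons.prems by simp
    moreover have "coeff F j \<in> A" for j using pCons.prems(2)[of "Suc j"] by simp
    ultimately show ?thesis using pCons.IH by blast
  next
    case False
    have "a = q * (- poly F q)" using eq by (simp add: eq_neg_iff_add_eq_0)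
    then have "q dvd a" by simp
    moreover have "a \<in> A" using pCons.prems(2)[of 0] by simp
    ultimately show ?thesis using False by blast
  qed
qed

text \<open>If \<open>q \<noteq> 0\<close> lies in the kernel, then for every \<open>k\<close> the constant term \<open>\<phi>\<^sup>k r\<close> of an integral
  equation of \<open>q\<close> over the image of \<open>\<phi>\<^sup>k\<close> witnesses that the kernel of \<open>\<phi>\<^sup>k\<close> is smaller than that of
  the next power. By Dickson's lemma the chain of kernels cannot ascend for ever.\<close>
lemma finite_hom_kernel_trivial:
  fixes \<phi> :: "('v::finite, 'k::field) mpoly \<Rightarrow> ('v, 'k) mpoly"
  assumes hom: "comm_ring_hom \<phi>" and fin: "finite_hom \<phi>" and q: "\<phi> q = 0"
  shows "q = 0"
proof (rule ccontr)
  assume "q \<noteq> 0"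
  interpret comm_ring_hom \<phi> by fact
  define K where "K k r \<longleftrightarrow> (\<phi> ^^ k) r \<noteq> 0 \<and> (\<phi> ^^ Suc k) r = 0" for k r
  have K_ex: "\<exists>r. K k r" for k
  proof -
    obtain F where F: "lead_coeff F = 1" "\<And>j. coeff F j \<in> range (\<phi> ^^ k)" "poly F q = 0"
      using integral_of_finite_hom[OF comm_ring_hom_funpow[OF hom] finite_hom_funpow[OF hom fin]]
      by metis
    obtain r where r: "(\<phi> ^^ k) r \<noteq> 0" "q dvd (\<phi> ^^ k) r"
      using integral_dvd_constant[OF \<open>q \<noteq> 0\<close> F] by blast
    then obtain d where "(\<phi> ^^ k) r = q * d" by (auto elim: dvdE)
    then have "(\<phi> ^^ Suc k) r = 0" using q by (simp add: hom_distribs)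
    then show ?thesis using r K_def by blast
  qed
  \<comment> \<open>For each \<open>k\<close> a witness with minimal leading monomial is
    chosen.\<close>
  have "\<exists>r a. K k r \<and> is_lead r a \<and> (\<forall>r' a'. K k r' \<longrightarrow> is_lead r' a' \<longrightarrow> \<not> mon_less a' a)" for k
  proof -
    interpret k: comm_ring_hom "\<phi> ^^ k" by (rule comm_ring_hom_funpow[OF hom])
    obtain r where r: "K k r" using K_ex by blast
    then have "r \<noteq> 0" unfolding K_def using k.hom_zero by metis
    then obtain a where "is_lead r a" using ex_is_lead by blast
    with r have "a \<in> {a. \<exists>r. K k r \<and> is_lead r a}" by blast
    from wfp_mon_less[unfolded wfp_eq_minimal, rule_format, OF this] show ?thesis by blast
  qed
  then obtain r a where ra: "\<And>k. K k (r k)" "\<And>k. is_lead (r k) (a k)"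
      "\<And>k r' a'. K k r' \<Longrightarrow> is_lead r' a' \<Longrightarrow> \<not> mon_less a' (a k)"
    by metis
  obtain i j where ij: "i < j" "\<And>v. lookup (a i) v \<le> lookup (a j) v" using dickson[of a] by blast
  obtain u where u: "\<And>b. is_lead (r j - u * r i) b \<Longrightarrow> mon_less b (a j)"
    using lead_reduction[OF ra(2) ra(2) ij(2)] by blast
  interpret j: comm_ring_hom "\<phi> ^^ j" by (rule comm_ring_hom_funpow[OF hom])
  interpret d: comm_ring_hom "\<phi> ^^ (j - Suc i)" by (rule comm_ring_hom_funpow[OF hom])
  \<comment> \<open>Since \<open>i < j\<close>, the iterate \<open>\<phi> ^^ j\<close> kills
    \<open>r i\<close>. So reducing \<open>r j\<close> by \<open>r i\<close> yields a witness for
    \<open>j\<close> with smaller leading monomial, against minimality.\<close>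
  have "(\<phi> ^^ j) (r i) = (\<phi> ^^ (j - Suc i)) ((\<phi> ^^ Suc i) (r i))"
    using ij(1) by (metis Suc_leI comp_apply funpow_add le_add_diff_inverse2)
  also have "\<dots> = 0" using ra(1)[of i] by (simp add: K_def)
  finally have "(\<phi> ^^ j) (r j - u * r i) = (\<phi> ^^ j) (r j)" by (simp add: hom_distribs)
  then have Kj: "K j (r j - u * r i)" using ra(1)[of j] by (simp add: K_def)
  then have "r j - u * r i \<noteq> 0" unfolding K_def using j.hom_zero by metis
  then obtain b where "is_lead (r j - u * r i) b" using ex_is_lead by blast
  then show False using u ra(3)[OF Kj] by blast
qed

section \<open>Counting monomials\<close>

text \<open>Stars and bars: the slack \<open>s - mon_deg a\<close> becomes an extra entry, turning
  the bound on the degree into a fixed sum.\<close>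

lemma card_mon_deg_le:
  "card {a :: 'v::finite \<Rightarrow>\<^sub>0 nat. mon_deg a \<le> s} = (s + card (UNIV :: 'v set)) choose (card (UNIV :: 'v set))"
proof -
  obtain vs :: "'v list" where vs: "set vs = UNIV" "distinct vs"
    using finite_distinct_list[OF finite_UNIV] by blast
  then have len: "length vs = card (UNIV :: 'v set)" using distinct_card by metis
  have deg: "mon_deg a = sum_list (map (lookup a) vs)" for a :: "'v \<Rightarrow>\<^sub>0 nat"
    unfolding mon_deg_eq_sum using sum_list_distinct_conv_sum_set[OF vs(2), of "lookup a"] vs(1) by simp
  define f where "f a = (s - mon_deg a) # map (lookup a) vs" for a :: "'v \<Rightarrow>\<^sub>0 nat"
  let ?A = "{a :: 'v \<Rightarrow>\<^sub>0 nat. mon_deg a \<le> s}"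
  let ?B = "{l :: nat list. length l = Suc (card (UNIV :: 'v set)) \<and> sum_list l = s}"
  have "bij_betw f ?A ?B"
  proof (rule bij_betw_imageI)
    show "inj_on f ?A"
    proof (rule inj_onI)
      fix a b assume "f a = f b"
      then have "\<forall>v\<in>set vs. lookup a v = lookup b v" by (simp add: f_def)
      then show "a = b" using vs(1) by (intro poly_mapping_eqI) auto
    qed
    show "f ` ?A = ?B"
    proof (intro equalityI subsetI)
      fix l assume "l \<in> f ` ?A"
      then show "l \<in> ?B" by (auto simp: f_def len deg)
    next
      fix l assume "l \<in> ?B"
      then obtain x ys where l: "l = x # ys" "length ys = card (UNIV :: 'v set)" "x + sum_list ys = s"
        by (cases l) auto
      define a where "a = Abs_poly_mapping (\<lambda>v. the (map_of (zip vs ys) v))"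
      have "lookup a = (\<lambda>v. the (map_of (zip vs ys) v))" unfolding a_def by (rule lookup_Abs_poly_mapping) simp
      then have "map (lookup a) vs = ys"
        using l(2) len vs(2) by (intro nth_equalityI) (auto simp: map_of_zip_nth)
      then have "f a = l" "a \<in> ?A" using l by (auto simp: f_def deg)
      then show "l \<in> f ` ?A" by blast
    qed
  qed
  then have "card ?A = card ?B" by (rule bij_betw_same_card)
  also have "\<dots> = (s + card (UNIV :: 'v set)) choose s" by (simp add: card_length_sum_list)
  also have "\<dots> = (s + card (UNIV :: 'v set)) choose (card (UNIV :: 'v set))"
    using binomial_symmetric[of s "s + card (UNIV :: 'v set)"] by simp
  finally show ?thesis .
qed

lemma finite_mon_deg_le: "finite {a :: 'v::finite \<Rightarrow>\<^sub>0 nat. mon_deg a \<le> s}"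
proof (rule finite_subset[OF _ finite_mon_box])
  show "{a :: 'v \<Rightarrow>\<^sub>0 nat. mon_deg a \<le> s} \<subseteq> {a. \<forall>i. lookup a i < Suc s}"
  proof (intro subsetI CollectI allI)
    fix a :: "'v \<Rightarrow>\<^sub>0 nat" and i assume "a \<in> {a. mon_deg a \<le> s}"
    moreover have "lookup a i \<le> mon_deg a" unfolding mon_deg_eq_sum by (rule member_le_sum) auto
    ultimately show "lookup a i < Suc s" by simp
  qed
qed

text \<open>The left side is the product of (es+i)/i over i = 1..n, and es+i is at most e(s+i) for
  each factor.\<close>

lemma binomial_scale_le: "(e * s + n) choose n \<le> e ^ n * ((s + n) choose n)" if "e \<ge> 1"
proof (induction n)
  case (Suc n)
  have "Suc n * ((e * s + Suc n) choose Suc n) = (e * s + Suc n) * ((e * s + n) choose n)"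
    using Suc_times_binomial_eq[of "e * s + n" n]
    by (simp only: add_Suc_right mult.commute[of "Suc n"])
  also have "\<dots> \<le> (e * (s + Suc n)) * (e ^ n * ((s + n) choose n))"
  proof (rule mult_mono)
    have "1 * Suc n \<le> e * Suc n" using that by (rule mult_le_mono1)
    then show "e * s + Suc n \<le> e * (s + Suc n)" by (simp only: distrib_left add_le_cancel_left mult_1)
  qed (use Suc.IH in simp_all)
  also have "\<dots> = e ^ Suc n * ((s + Suc n) * ((s + n) choose n))"
    by (simp only: power_Suc mult_ac)
  also have "(s + Suc n) * ((s + n) choose n) = Suc n * ((s + Suc n) choose Suc n)"
    using Suc_times_binomial_eq[of "s + n" n] by (simp only: add_Suc_right mult.commute)
  finally have "Suc n * ((e * s + Suc n) choose Suc n) \<le> Suc n * (e ^ Suc n * ((s + Suc n) choose Suc n))"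
    by (simp only: mult_ac)
  then show ?case by (simp only: Suc_mult_le_cancel1)
qed simp

lemma binomial_step: "real (Suc s) * real ((Suc s + n) choose n) = real (Suc s + n) * real ((s + n) choose n)"
proof -
  have "Suc s * (Suc (s + n) choose Suc s) = Suc (s + n) * ((s + n) choose s)"
    using Suc_times_binomial_eq[of "s + n" s] by (simp add: mult.commute)
  moreover have "Suc (s + n) choose Suc s = (Suc s + n) choose n" "(s + n) choose s = (s + n) choose n"
    using binomial_symmetric[of "Suc s" "Suc s + n"] binomial_symmetric[of s "s + n"] by simp_all
  ultimately have "Suc s * ((Suc s + n) choose n) = (Suc s + n) * ((s + n) choose n)" by simp
  then show ?thesis by (metis of_nat_mult)
qed

text \<open>Raising \<open>s + a\<close> by one multiplies the binomial by 1 + n/(s+a+1); the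
  product of these ratios is estimated by 1/(1 - na/(s+1)), here cleared of denominators. Over the
  reals subtraction is not truncated.\<close>

lemma binomial_shift_le:
  assumes "n * a \<le> Suc s"
  shows "real ((s + a + n) choose n) * (real (Suc s) - real (n * a)) \<le> real (Suc s) * real ((s + n) choose n)"
  using assms
proof (induction a)
  case (Suc a)
  define X where "X = real (Suc s) - real (n * a)"
  define Y where "Y = real (Suc (s + a))"
  have "X \<le> real (Suc s)" by (simp add: X_def)
  also have "\<dots> \<le> Y" by (simp add: Y_def)
  finally have X: "X \<le> Y" .
  define M where "M = real ((s + a + n) choose n)"
  define M' where "M' = real ((s + Suc a + n) choose n)"
  have "s + Suc a + n = Suc (s + a) + n" by simp
  then have "M' = real ((Suc (s + a) + n) choose n)" by (simp only: M'_def)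
  then have YM: "Y * M' = (Y + real n) * M"
    using binomial_step[of "s + a" n] by (simp only: Y_def M_def of_nat_add[of "Suc (s + a)" n])
  have "Y * (M' * (X - real n)) = (Y * M') * (X - real n)" by (simp only: mult.assoc)
  also have "\<dots> = ((Y + real n) * M) * (X - real n)" by (simp only: YM)
  also have "\<dots> = ((Y + real n) * (X - real n)) * M" by (simp only: mult_ac)
  \<comment> \<open>The product equals YX - n(Y - X) - n^2, and X \<le> Y.\<close>
  also have "\<dots> \<le> (Y * X) * M"
  proof (rule mult_right_mono)
    have "real n * X \<le> real n * Y" using X by (intro mult_left_mono) auto
    moreover have "(Y + real n) * (X - real n) = Y * X - (real n * Y - real n * X) - real n * real n"
      by (simp add: algebra_simps)
    ultimately show "(Y + real n) * (X - real n) \<le> Y * X"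
      using zero_le_square[of "real n"] by linarith
  qed (simp add: M_def)
  finally have "Y * (M' * (X - real n)) \<le> Y * (X * M)" by (simp only: mult.assoc)
  moreover have "Y > 0" by (simp add: Y_def)
  ultimately have "M' * (X - real n) \<le> X * M" using mult_le_cancel_left_pos by blast
  also have "X * M \<le> real (Suc s) * real ((s + n) choose n)"
    using Suc.IH Suc.prems unfolding X_def M_def by (simp add: mult.commute)
  finally have "M' * (X - real n) \<le> real (Suc s) * real ((s + n) choose n)" .
  moreover have "X - real n = real (Suc s) - real (n * Suc a)" by (simp add: X_def)
  ultimately show ?case by (simp only: M'_def)
qed simp

text \<open>With a = e^(n-1) and E = e^n one has em + E = e(m+a). Scaling costs the factor E and the
  shift by a the factor (m+1)/(m+1-na), so it suffices that (E+1)na < m+1.\<close>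

lemma monomial_count_ineq:
  fixes e n :: nat
  assumes "e \<ge> 1" "n \<ge> 1"
  defines "m \<equiv> 2 ^ n * e ^ (n - 1) * (n + e ^ n)"
  shows "(e * m + e ^ n + n) choose n < (e ^ n + 1) * ((m + n) choose n)"
proof -
  define a where "a = e ^ (n - 1)"
  define E where "E = e ^ n"
  have E: "E = e * a" using assms(2) by (cases n) (simp_all add: E_def a_def)
  have m: "m = 2 ^ n * a * (n + E)" by (simp add: m_def a_def E_def)
  have "n \<le> 2 ^ n" by (simp add: less_imp_le)
  \<comment> \<open>This determines a sufficient size of \<open>m\<close>; its factor
    \<open>2 ^ n\<close> serves as an upper bound for \<open>n\<close>.\<close>
  have "(E + 1) * (n * a) = a * (n * E + n * 1)" by (simp add: algebra_simps)
  also have "\<dots> \<le> a * (2 ^ n * E + 2 ^ n * n)"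
    using \<open>n \<le> 2 ^ n\<close> assms(2) by (intro mult_le_mono add_mono) auto
  also have "\<dots> = m" by (simp add: m algebra_simps)
  finally have small: "(E + 1) * (n * a) < Suc m" by simp
  then have "n * a < Suc m" by (simp add: algebra_simps)
  define S where "S = real (Suc m)"
  define Z where "Z = S - real (n * a)"
  have Z: "Z > 0" using \<open>n * a < Suc m\<close> by (simp add: Z_def S_def del: of_nat_mult of_nat_Suc)
  define M where "M = real ((m + n) choose n)"
  define M' where "M' = real ((m + a + n) choose n)"
  have M: "M > 0" by (simp add: M_def)
  have "real E * S < (real E + 1) * Z"
  proof -
    have "real ((E + 1) * (n * a)) < S" using small unfolding S_def of_nat_less_iff .
    then show ?thesis by (simp add: Z_def algebra_simps)
  qed
  moreover have "M' * Z \<le> S * M"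
    using binomial_shift_le[of n a m] \<open>n * a < Suc m\<close> by (simp add: M'_def M_def Z_def S_def)
  then have "real E * (M' * Z) \<le> real E * (S * M)" by (intro mult_left_mono) auto
  ultimately have "(real E * M') * Z < ((real E + 1) * M) * Z"
    using mult_strict_right_mono[OF _ M] by (smt (verit) mult.assoc mult.commute)
  then have "real E * M' < (real E + 1) * M" using Z by (simp add: mult_less_cancel_right_pos)
  then have "real (E * ((m + a + n) choose n)) < real ((E + 1) * ((m + n) choose n))"
    by (simp add: M_def M'_def algebra_simps)
  then have "E * ((m + a + n) choose n) < (E + 1) * ((m + n) choose n)"
    unfolding of_nat_less_iff .
  moreover have "(e * m + E + n) choose n \<le> E * ((m + a + n) choose n)"
    using binomial_scale_le[OF assms(1), of "m + a" n] by (simp add: E E_def[symmetric] algebra_simps)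
  ultimately show ?thesis by (simp add: E_def)
qed

section \<open>Linear relations from a dimension count\<close>

lemma vector_space_mpoly: "vector_space (\<lambda>c (p :: ('v, 'k::field) mpoly). mconst c * p)"
  by unfold_locales
    (simp_all add: mconst_def distrib_left distrib_right single_add mult_single flip: mult.assoc)

lemma exists_linear_relation:
  fixes f :: "'u \<Rightarrow> ('v::finite, 'k::field) mpoly"
  assumes fin: "finite U" and deg: "\<And>u. u \<in> U \<Longrightarrow> tdeg (f u) \<le> D"
    and card: "card {a :: 'v \<Rightarrow>\<^sub>0 nat. mon_deg a \<le> D} < card U"
  shows "\<exists>c. (\<exists>u\<in>U. c u \<noteq> 0) \<and> (\<Sum>u\<in>U. mconst (c u) * f u) = 0"
proof (cases "inj_on f U")
  \<comment> \<open>Linear dependence concerns the set of values, so a repeated value is treated by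
    the relation \<open>f u - f v = 0\<close>.\<close>
  case False
  then obtain u v where uv: "u \<in> U" "v \<in> U" "u \<noteq> v" "f u = f v" by (auto simp: inj_on_def)
  define c :: "'u \<Rightarrow> 'k" where "c x = (if x = u then 1 else 0) - (if x = v then 1 else 0)" for x
  have "mconst (c x) * f x = (if x = u then f x else 0) - (if x = v then f x else 0)" for x
    by (auto simp: c_def mconst_def single_uminus)
  then have "(\<Sum>x\<in>U. mconst (c x) * f x) = f u - f v"
    using fin uv by (simp add: sum_subtractf)
  moreover have "c u \<noteq> 0" using uv by (simp add: c_def)
  ultimately show ?thesis using uv by auto
next
  case True
  interpret V: vector_space "\<lambda>c (p :: ('v, 'k) mpoly). mconst c * p" by (rule vector_space_mpoly)
  define T :: "('v, 'k) mpoly set" where "T = (\<lambda>a. single a 1) ` {a. mon_deg a \<le> D}"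
  have T: "finite T" "card T \<le> card {a :: 'v \<Rightarrow>\<^sub>0 nat. mon_deg a \<le> D}"
    unfolding T_def using finite_mon_deg_le card_image_le by blast+
  have "f u \<in> V.span T" if "u \<in> U" for u
  proof -
    have "(\<Sum>a\<in>keys (f u). mconst (lookup (f u) a) * single a 1) \<in> V.span T"
      using deg[OF that] unfolding tdeg_le_iff
      by (intro V.span_sum V.span_scale V.span_base) (auto simp: T_def)
    then show ?thesis by (simp add: mconst_def mult_single sum_monomials)
  qed
  then have "f ` U \<subseteq> V.span T" by blast
  moreover have "card (f ` U) > card T" using card T card_image[OF True] by simp
  ultimately have "V.dependent (f ` U)" using V.independent_span_bound[OF T(1)] by fastforce
  then obtain c where "\<exists>v\<in>f ` U. c v \<noteq> 0" "(\<Sum>v\<in>f ` U. mconst (c v) * v) = 0"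
    using V.dependent_finite[of "f ` U"] fin by blast
  then show ?thesis using sum.reindex[OF True, of "\<lambda>v. mconst (c v) * v"]
    by (intro exI[of _ "c \<circ> f"]) auto
qed

section \<open>Total degrees of the coefficients of a factor\<close>

lemma tdeg_uminus: "tdeg (- p :: ('v, 'k::field) mpoly) = tdeg p"
proof -
  have "keys (- p) = keys p" by (auto simp: in_keys_iff)
  then show ?thesis by (simp add: tdeg_def)
qed

text \<open>Selects the last coefficient of maximal total degree, the pivot of a Gauss-lemma
  argument.\<close>

lemma exists_last_top_coeff:
  fixes F :: "('v::finite, 'k::field) mpoly poly"
  assumes "F \<noteq> 0"
  shows "\<exists>j. coeff F j \<noteq> 0 \<and> (\<forall>i. tdeg (coeff F i) \<le> tdeg (coeff F j)) \<and>
    (\<forall>i>j. coeff F i = 0 \<or> tdeg (coeff F i) < tdeg (coeff F j))"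
proof -
  define I where "I = {i. coeff F i \<noteq> 0}"
  have I: "finite I" "I \<noteq> {}"
    using assms by (auto simp: I_def MOST_coeff_eq_0 eventually_cofinite[symmetric] poly_eq_iff)
  define D where "D = Max ((\<lambda>i. tdeg (coeff F i)) ` I)"
  have D: "tdeg (coeff F i) \<le> D" for i
    by (cases "i \<in> I") (use I in \<open>auto simp: D_def I_def\<close>)
  have "D \<in> (\<lambda>i. tdeg (coeff F i)) ` I" unfolding D_def using I by (intro Max_in) auto
  then have J: "finite {i\<in>I. tdeg (coeff F i) = D}" "{i\<in>I. tdeg (coeff F i) = D} \<noteq> {}"
    using I by auto
  define j where "j = Max {i\<in>I. tdeg (coeff F i) = D}"
  have j: "j \<in> {i\<in>I. tdeg (coeff F i) = D}" unfolding j_def using J by (rule Max_in)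
  have "coeff F i = 0 \<or> tdeg (coeff F i) < D" if "i > j" for i
  proof (rule ccontr)
    assume "\<not> ?thesis"
    then have "i \<in> {i\<in>I. tdeg (coeff F i) = D}" using D[of i] by (auto simp: I_def)
    then have "i \<le> j" unfolding j_def using J(1) by simp
    then show False using that by simp
  qed
  then show ?thesis using j D by (auto simp: I_def)
qed

text \<open>In coefficient \<open>j + k\<close> of the product, the product of the two pivots has
  strictly larger total degree than every other term and cannot cancel; so the maximal degrees of
  the factors add up to at most \<open>m\<close>.\<close>

lemma tdeg_coeff_factor_le:
  fixes F Q :: "('v::finite, 'k::field) mpoly poly"
  assumes nz: "F * Q \<noteq> 0" and deg: "\<And>i. tdeg (coeff (F * Q) i) \<le> m"
  shows "tdeg (coeff F i) \<le> m"
proof -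
  obtain j where j: "coeff F j \<noteq> 0" "\<And>i. tdeg (coeff F i) \<le> tdeg (coeff F j)"
      "\<And>i. i > j \<Longrightarrow> coeff F i = 0 \<or> tdeg (coeff F i) < tdeg (coeff F j)"
    using exists_last_top_coeff[of F] nz by (metis mult_zero_left)
  obtain k where k: "coeff Q k \<noteq> 0" "\<And>i. tdeg (coeff Q i) \<le> tdeg (coeff Q k)"
      "\<And>i. i > k \<Longrightarrow> coeff Q i = 0 \<or> tdeg (coeff Q i) < tdeg (coeff Q k)"
    using exists_last_top_coeff[of Q] nz by (metis mult_zero_right)
  define D where "D = tdeg (coeff F j) + tdeg (coeff Q k)"
  have D: "tdeg (coeff F j * coeff Q k) = D" using j k by (simp add: tdeg_mult D_def)
  have "D \<le> m"
  proof (rule ccontr)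
    assume less: "\<not> D \<le> m"
    let ?t = "\<lambda>i. coeff F i * coeff Q (j + k - i)"
    have "coeff (F * Q) (j + k) = ?t j + (\<Sum>i\<in>{..j+k} - {j}. ?t i)"
      unfolding coeff_mult by (subst sum.remove[of _ j]) auto
    then have "coeff F j * coeff Q k = coeff (F * Q) (j + k) + - (\<Sum>i\<in>{..j+k} - {j}. ?t i)"
      by simp
    \<comment> \<open>Any other nonzero term has a factor past \<open>j\<close> or past
      \<open>k\<close>, hence smaller degree. \<open>D - 1\<close> is not truncated because
      \<open>D > m\<close>.\<close>
    also have "tdeg \<dots> \<le> D - 1"
    proof (rule tdeg_add_le)
      show "tdeg (coeff (F * Q) (j + k)) \<le> D - 1" using deg[of "j + k"] less by simp
      have "tdeg (?t i) \<le> D - 1" if i: "i \<in> {..j+k} - {j}" for i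
      proof (cases "?t i = 0")
        case False
        then have nz': "coeff F i \<noteq> 0" "coeff Q (j + k - i) \<noteq> 0" by auto
        have "tdeg (coeff F i) + tdeg (coeff Q (j + k - i)) < D"
        proof (cases "i > j")
          case True
          then show ?thesis using j(3)[OF True] k(2)[of "j + k - i"] nz' by (simp add: D_def)
        next
          case False
          then have "j + k - i > k" using i by auto
          then show ?thesis using k(3) j(2)[of i] nz' unfolding D_def by (metis add_le_less_mono)
        qed
        then show ?thesis using tdeg_mult_le[of "coeff F i" "coeff Q (j + k - i)"] by simp
      qed simp
      then show "tdeg (- (\<Sum>i\<in>{..j+k} - {j}. ?t i)) \<le> D - 1"
        unfolding tdeg_uminus by (rule tdeg_sum_le)
    qed
    finally show False using D less by simp
  qed
  then show ?thesis using j(2)[of i] by (simp add: D_def)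
qed

section \<open>Relations of bounded degree\<close>

lemma tdeg_hom_var_le: "tdeg (\<phi> (mvar i)) \<le> hom_deg \<phi>"
  unfolding hom_deg_def by (rule Max_ge) auto

lemma tdeg_hom_monomial_le:
  fixes \<phi> :: "('v::finite, 'k::field) mpoly \<Rightarrow> ('v, 'k) mpoly"
  assumes "is_K_alg_hom \<phi>"
  shows "tdeg (\<phi> (single a 1)) \<le> hom_deg \<phi> * mon_deg a"
proof (induction a rule: mon_induct)
  case zero
  interpret comm_ring_hom \<phi> by (rule is_K_alg_homD[OF assms])
  show ?case by simp
next
  case (step i a)
  interpret comm_ring_hom \<phi> by (rule is_K_alg_homD[OF assms])
  have "single (single i 1 + a) 1 = mvar i * single a (1 :: 'k)"
    by (simp add: mvar_def mult_single)
  then have "tdeg (\<phi> (single (single i 1 + a) 1)) \<le> tdeg (\<phi> (mvar i)) + tdeg (\<phi> (single a 1))"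
    by (simp add: hom_mult tdeg_mult_le)
  also have "\<dots> \<le> hom_deg \<phi> + hom_deg \<phi> * mon_deg a"
    using tdeg_hom_var_le step by (rule add_mono)
  finally show ?case by (simp add: mon_deg_add)
qed

lemma exists_bounded_relation:
  fixes \<phi> :: "('v::finite, 'k::field) mpoly \<Rightarrow> ('v, 'k) mpoly"
  assumes \<phi>: "is_K_alg_hom \<phi>"
  defines "n \<equiv> card (UNIV :: 'v set)" and "e \<equiv> hom_deg \<phi>"
  defines "m \<equiv> 2 ^ n * e ^ (n - 1) * (n + e ^ n)"
  assumes e: "e \<ge> 1"
  shows "\<exists>P. P \<noteq> 0 \<and> degree P \<le> e ^ n \<and> (\<forall>j. tdeg (coeff P j) \<le> m) \<and>
    poly (map_poly \<phi> P) (mvar i) = 0"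
proof -
  interpret comm_ring_hom \<phi> by (rule is_K_alg_homD[OF \<phi>])
  have n: "n \<ge> 1" by (simp add: n_def Suc_leI card_gt_0_iff)
  define A where "A = {a :: 'v \<Rightarrow>\<^sub>0 nat. mon_deg a \<le> m}"
  have A: "finite A" unfolding A_def by (rule finite_mon_deg_le)
  \<comment> \<open>The pair \<open>(a, j)\<close> indexes the monomial y^a T^j of the relation
    sought; \<open>f\<close> gives its value at the images of the variables and
    \<open>mvar i\<close>.\<close>
  define U where "U = A \<times> {..e ^ n}"
  define f where "f = (\<lambda>(a, j). \<phi> (single a 1) * mvar i ^ j)"
  have fin: "finite U" using A by (simp add: U_def)
  have deg: "tdeg (f u) \<le> e * m + e ^ n" if uU: "u \<in> U" for u
  proof -
    obtain a j where u: "u = (a, j)" "mon_deg a \<le> m" "j \<le> e ^ n"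
      using uU by (auto simp: U_def A_def)
    have "tdeg (mvar i ^ j :: ('v, 'k) mpoly) \<le> j" by (simp add: mvar_power tdeg_def)
    moreover have "tdeg (\<phi> (single a 1)) \<le> e * m"
      using tdeg_hom_monomial_le[OF \<phi>, of a] u(2) unfolding e_def
      by (meson mult_le_mono2 order_trans)
    ultimately show ?thesis
      using tdeg_mult_le[of "\<phi> (single a 1)" "mvar i ^ j"] u by (simp add: f_def)
  qed
  have "card U = (e ^ n + 1) * ((m + n) choose n)"
    by (simp add: U_def A_def card_cartesian_product card_mon_deg_le n_def)
  then have card: "card {a :: 'v \<Rightarrow>\<^sub>0 nat. mon_deg a \<le> e * m + e ^ n} < card U"
    using monomial_count_ineq[OF e n] by (simp add: card_mon_deg_le n_def[symmetric] m_def)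
  have "\<exists>c. (\<exists>u\<in>U. c u \<noteq> 0) \<and> (\<Sum>u\<in>U. mconst (c u) * f u) = 0"
    by (rule exists_linear_relation[OF fin _ card]) (rule deg)
  then obtain c where c: "\<exists>u\<in>U. c u \<noteq> 0" "(\<Sum>u\<in>U. mconst (c u) * f u) = 0"
    by (elim exE conjE)
  \<comment> \<open>The linear relation is collected by powers of T.\<close>
  define q where "q j = (\<Sum>a\<in>A. single a (c (a, j)))" for j
  define P where "P = (\<Sum>j\<le>e ^ n. monom (q j) j)"
  have coeff_P: "coeff P j = (if j \<le> e ^ n then q j else 0)" for j
    by (simp add: P_def coeff_sum)
  obtain a j where aj: "a \<in> A" "j \<le> e ^ n" "c (a, j) \<noteq> 0" using c(1) by (auto simp: U_def)
  have "lookup (q j) a = c (a, j)"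
    using A aj(1) by (simp add: q_def lookup_sum lookup_single when_def)
  then have "coeff P j \<noteq> 0" using aj by (auto simp: coeff_P)
  then have "P \<noteq> 0" by auto
  moreover have "degree P \<le> e ^ n" by (rule degree_le) (simp add: coeff_P)
  moreover have "tdeg (coeff P j) \<le> m" for j
  proof -
    have "tdeg (q j) \<le> m"
      unfolding q_def by (rule tdeg_sum_le) (auto simp: tdeg_le_iff A_def split: if_splits)
    then show ?thesis by (simp add: coeff_P)
  qed
  moreover have "poly (map_poly \<phi> P) (mvar i) = 0"
  proof -
    interpret mp: map_poly_comm_ring_hom \<phi> ..
    have \<phi>c: "\<phi> (single a c) = mconst c * \<phi> (single a 1)" for a c
    proof -
      have "single a c = mconst c * single a 1" by (simp add: mconst_def mult_single)
      then show ?thesis by (simp add: hom_mult is_K_alg_homD(2)[OF \<phi>])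
    qed
    have \<phi>q: "\<phi> (q j) = (\<Sum>a\<in>A. mconst (c (a, j)) * \<phi> (single a 1))" for j
      unfolding q_def hom_sum by (intro sum.cong refl \<phi>c)
    have "poly (map_poly \<phi> P) (mvar i) = (\<Sum>j\<le>e ^ n. \<phi> (q j) * mvar i ^ j)"
      by (simp add: P_def mp.hom_sum poly_sum poly_monom)
    also have "\<dots> = (\<Sum>j\<le>e ^ n. \<Sum>a\<in>A. mconst (c (a, j)) * f (a, j))"
      by (simp add: \<phi>q f_def sum_distrib_right mult.assoc)
    also have "\<dots> = (\<Sum>u\<in>U. mconst (c u) * f u)"
      unfolding U_def by (subst sum.swap) (simp add: sum.cartesian_product)
    finally show ?thesis using c(2) by simp
  qed
  ultimately show ?thesis by blast
qed

section \<open>The minimal monic relation\<close>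

text \<open>A relation of least degree in T is divided by its leading coefficient; comparison with
  the monic \<open>G\<close> shows that this is possible, and injectivity that the quotient is still
  a relation.\<close>

lemma exists_monic_generator:
  fixes \<phi> :: "('v::finite, 'k::field) mpoly \<Rightarrow> ('v, 'k) mpoly"
  assumes hom: "comm_ring_hom \<phi>" and inj: "\<And>q. \<phi> q = 0 \<Longrightarrow> q = 0"
    and G: "lead_coeff G = 1" "poly (map_poly \<phi> G) x = 0"
  shows "\<exists>F. lead_coeff F = 1 \<and> poly (map_poly \<phi> F) x = 0 \<and>
    (\<forall>P. poly (map_poly \<phi> P) x = 0 \<longrightarrow> F dvd P)"
proof -
  interpret comm_ring_hom \<phi> by fact
  interpret mp: map_poly_comm_ring_hom \<phi> ..
  define ev where "ev P = poly (map_poly \<phi> P) x" for P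
  have ev: "ev (P + Q) = ev P + ev Q" "ev (P - Q) = ev P - ev Q" "ev (P * Q) = ev P * ev Q"
      "ev (smult a P) = \<phi> a * ev P" for P Q a
    by (simp_all add: ev_def mp.hom_add mp.hom_minus mp.hom_mult hom_distribs)
  have "G \<noteq> 0 \<and> ev G = 0" using G by (auto simp: ev_def)
  then obtain P where P: "P \<noteq> 0" "ev P = 0" and
      min: "\<And>Q. Q \<noteq> 0 \<Longrightarrow> ev Q = 0 \<Longrightarrow> degree P \<le> degree Q"
    using ex_has_least_nat[of "\<lambda>Q. Q \<noteq> 0 \<and> ev Q = 0" G degree] by blast
  define p where "p = lead_coeff P"
  have p: "p \<noteq> 0" using P by (simp add: p_def)
  \<comment> \<open>The pseudo-remainder is again a relation, so minimality of the degree of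
    \<open>P\<close> makes it zero.\<close>
  obtain H r where Hr: "pseudo_divmod G P = (H, r)" by (cases "pseudo_divmod G P")
  define k where "k = Suc (degree G) - degree P"
  have eq: "smult (p ^ k) G = P * H + r" and r: "r = 0 \<or> degree r < degree P"
    using pseudo_divmod[OF P(1) Hr] by (auto simp: p_def k_def)
  have "r = smult (p ^ k) G - P * H" using eq by simp
  then have "ev r = 0" using P(2) G(2) by (simp add: ev) (simp add: ev_def)
  then have "r = 0" using min[of r] r by (meson not_le)
  with eq have "smult (p ^ k) G = P * H" by simp
  then have dvd: "p dvd coeff P j" for j
    unfolding p_def
    by (rule lead_coeff_dvd_of_smult_monic_eq_mult[OF _ G(1)])
      (use mpoly_power_nonzero[OF p] in \<open>simp add: p_def\<close>)
  have "\<forall>j. \<exists>c. coeff P j = p * c" using dvd by (auto elim: dvdE)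
  then obtain c where c: "\<And>j. coeff P j = p * c j" by metis
  define F where "F = (\<Sum>j\<le>degree P. monom (c j) j)"
  have c0: "c j = 0" if "j > degree P" for j
    using c[of j] that p by (simp add: coeff_eq_0 mpoly_mult_eq_0)
  have coeff_F: "coeff F j = c j" for j
    using c0[of j] by (auto simp: F_def coeff_sum)
  have PF: "P = smult p F" by (rule poly_eqI) (simp add: c coeff_F)
  have "p * c (degree P) = p * 1" using c[of "degree P"] by (simp add: p_def)
  then have c1: "c (degree P) = 1" using mpoly_mult_left_cancel[OF p] by blast
  have degF: "degree F = degree P"
  proof (rule antisym)
    show "degree F \<le> degree P" by (rule degree_le) (simp add: coeff_F c0)
    show "degree P \<le> degree F" by (rule le_degree) (simp add: coeff_F c1)
  qed
  have lF: "lead_coeff F = 1" using c1 by (simp add: degF coeff_F)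
  \<comment> \<open>Here injectivity gives \<open>\<phi> p \<noteq> 0\<close>, which permits
    cancellation.\<close>
  have "\<phi> p * ev F = 0" using P(2) by (simp add: PF ev)
  then have evF: "ev F = 0" using inj[of p] p by (auto simp: mpoly_mult_eq_0)
  have "F dvd Q" if Q: "ev Q = 0" for Q
  proof -
    have "F \<noteq> 0" using lF by auto
    \<comment> \<open>For a monic divisor pseudo-division is ordinary division, the scaling factor
      being a power of 1.\<close>
    obtain H r where Hr: "pseudo_divmod Q F = (H, r)" by (cases "pseudo_divmod Q F")
    have eq: "Q = F * H + r" and r: "r = 0 \<or> degree r < degree F"
      using pseudo_divmod[OF \<open>F \<noteq> 0\<close> Hr] lF by auto
    have "ev r = 0" using Q evF by (simp add: eq ev)
    then have "r = 0" using min[of r] r degF by (metis not_le)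
    then show ?thesis using eq by simp
  qed
  then show ?thesis using lF evF by (auto simp: ev_def)
qed

lemma integral_hom_imp_finite_hom:
  fixes \<phi> :: "('v::finite, 'k::field) mpoly \<Rightarrow> ('v, 'k) mpoly"
  assumes "is_K_alg_hom \<phi>" "integral_hom \<phi>"
  shows "finite_hom \<phi>"
  by (rule finite_hom_of_integral_vars[OF assms(1)]) (use assms(2) in \<open>unfold integral_hom_def, blast\<close>)

text \<open>If every image were constant, \<open>mvar i - mconst c\<close> would be a nonzero kernel
  element for some \<open>c\<close>. This supplies \<open>e \<ge> 1\<close> for the count.\<close>

lemma hom_deg_pos:
  fixes \<phi> :: "('v::finite, 'k::field) mpoly \<Rightarrow> ('v, 'k) mpoly"
  assumes \<phi>: "is_K_alg_hom \<phi>" and inj: "\<And>q. \<phi> q = 0 \<Longrightarrow> q = 0"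
  shows "hom_deg \<phi> \<ge> 1"
proof (rule ccontr)
  interpret comm_ring_hom \<phi> by (rule is_K_alg_homD[OF \<phi>])
  fix i :: 'v
  assume "\<not> hom_deg \<phi> \<ge> 1"
  then have "tdeg (\<phi> (mvar i)) = 0" using tdeg_hom_var_le[of \<phi> i] by simp
  then have "mon_deg a = 0" if "a \<in> keys (\<phi> (mvar i))" for a
    using that by (metis le_zero_eq order_refl tdeg_le_iff)
  then have keys: "a = 0" if "a \<in> keys (\<phi> (mvar i))" for a
    using that by (intro poly_mapping_eqI) (simp add: mon_deg_eq_sum)
  define c where "c = lookup (\<phi> (mvar i)) 0"
  have "\<phi> (mvar i) = mconst c"
  proof (rule poly_mapping_eqI)
    fix a show "lookup (\<phi> (mvar i)) a = lookup (mconst c) a"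
      using keys[of a] by (cases "a = 0") (auto simp: c_def mconst_def lookup_single in_keys_iff)
  qed
  then have "\<phi> (mvar i - mconst c) = 0" by (simp add: hom_minus is_K_alg_homD(2)[OF \<phi>])
  then have "mvar i = mconst c" using inj by fastforce
  then have "lookup (mvar i) (single i 1) = lookup (mconst c) (single i 1)" by simp
  moreover have "single i (1 :: nat) \<noteq> 0" by (metis lookup_single_eq lookup_zero one_neq_zero)
  ultimately show False by (simp add: mvar_def mconst_def lookup_single when_def)
qed

section \<open>Integrality and monic equations of bounded degree\<close>

theorem theorem4p5:
  fixes \<phi> :: "('v::finite, 'k::field) mpoly \<Rightarrow> ('v, 'k) mpoly"
  assumes "is_K_alg_hom \<phi>"
  defines "n \<equiv> card (UNIV :: 'v set)"
  defines "e \<equiv> hom_deg \<phi>"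
  defines "m \<equiv> 2 ^ n * e ^ (n - 1) * (n + e ^ n)"
  shows "integral_hom \<phi> \<longleftrightarrow>
    (\<forall>i. \<exists>F :: ('v, 'k) mpoly poly.
        lead_coeff F = 1 \<and> degree F = e ^ n \<and>
        (\<forall>j. coeff F j \<in> \<phi> ` {p. tdeg p \<le> m}) \<and>
        poly F (mvar i) = 0)"
proof
  assume int: "integral_hom \<phi>"
  interpret comm_ring_hom \<phi> by (rule is_K_alg_homD[OF assms(1)])
  interpret mp: map_poly_comm_ring_hom \<phi> ..
  have fin: "finite_hom \<phi>" using assms(1) int by (rule integral_hom_imp_finite_hom)
  have ker: "\<phi> q = 0 \<Longrightarrow> q = 0" for q
    using finite_hom_kernel_trivial[OF is_K_alg_homD(1)[OF assms(1)] fin] .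
  have "inj \<phi>"
  proof (rule injI)
    fix x y assume "\<phi> x = \<phi> y"
    then have "\<phi> (x - y) = 0" by (simp add: hom_minus)
    then show "x = y" using ker by fastforce
  qed
  have e: "e \<ge> 1" unfolding e_def by (rule hom_deg_pos[OF assms(1) ker])
  show "\<forall>i. \<exists>F :: ('v, 'k) mpoly poly. lead_coeff F = 1 \<and> degree F = e ^ n \<and>
      (\<forall>j. coeff F j \<in> \<phi> ` {p. tdeg p \<le> m}) \<and> poly F (mvar i) = 0"
  proof
    fix i :: 'v
    obtain G' where G': "lead_coeff G' = 1" "\<And>j. coeff G' j \<in> range \<phi>" "poly G' (mvar i) = 0"
      using int unfolding integral_hom_def by blast
    \<comment> \<open>Injectivity lets the equation be pulled back to the source of
      \<open>\<phi>\<close>, with its degree and leading coefficient.\<close>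
    define G where "G = map_poly (inv_into UNIV \<phi>) G'"
    have inv: "inv_into UNIV \<phi> 0 = 0" "inv_into UNIV \<phi> 1 = 1"
      using inv_f_f[OF \<open>inj \<phi>\<close>] hom_zero hom_one by metis+
    have coeff_G: "coeff G j = inv_into UNIV \<phi> (coeff G' j)" for j
      unfolding G_def using inv(1) by (rule coeff_map_poly)
    have "map_poly \<phi> G = G'"
      by (rule poly_eqI) (simp add: coeff_G f_inv_into_f[OF G'(2)])
    moreover have "degree G = degree G'"
    proof (rule antisym)
      show "degree G \<le> degree G'" by (rule degree_le) (simp add: coeff_G coeff_eq_0 inv)
      show "degree G' \<le> degree G" by (rule le_degree) (simp add: coeff_G inv G'(1))
    qed
    then have "lead_coeff G = 1" using G'(1) inv by (simp add: coeff_G)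
    ultimately obtain F where F: "lead_coeff F = 1" "poly (map_poly \<phi> F) (mvar i) = 0"
        "\<And>P. poly (map_poly \<phi> P) (mvar i) = 0 \<Longrightarrow> F dvd P"
      using exists_monic_generator[OF is_K_alg_homD(1)[OF assms(1)] ker, of G "mvar i"] G'(3)
      by metis
    obtain P where P: "P \<noteq> 0" "degree P \<le> e ^ n" "\<And>j. tdeg (coeff P j) \<le> m"
        "poly (map_poly \<phi> P) (mvar i) = 0"
      using exists_bounded_relation[OF assms(1) e[unfolded e_def], of i]
      unfolding n_def e_def m_def by blast
    obtain Q where Q: "P = F * Q" using F(3)[OF P(4)] by (auto elim: dvdE)
    have tdeg_F: "tdeg (coeff F j) \<le> m" for j
      using tdeg_coeff_factor_le[of F Q] P Q by blast
    have "Q \<noteq> 0" using P Q by auto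
    \<comment> \<open>As \<open>F\<close> is monic, degrees in T add, so \<open>F\<close> inherits
      the bound on the degree of \<open>P\<close>.\<close>
    have "coeff P (degree F + degree Q) = lead_coeff Q"
      using F(1) by (simp add: Q coeff_mult_degree_sum)
    then have "degree F + degree Q \<le> degree P" using \<open>Q \<noteq> 0\<close> by (intro le_degree) simp
    then have dF: "degree F \<le> e ^ n" using P(2) by simp
    \<comment> \<open>Multiplying by T^d raises the degree to exactly \<open>e ^ n\<close>; the new
      coefficients are 0, the image of 0.\<close>
    define d where "d = e ^ n - degree F"
    define H where "H = monom 1 d * F"
    have coeff_H: "coeff H j = (if j < d then 0 else coeff F (j - d))" for j
      by (simp add: H_def coeff_monom_mult)
    have degH: "degree (map_poly \<phi> H) = e ^ n"
    proof (rule antisym)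
      show "degree (map_poly \<phi> H) \<le> e ^ n"
        using dF by (intro degree_le) (auto simp: coeff_H d_def coeff_eq_0)
      show "e ^ n \<le> degree (map_poly \<phi> H)"
        using dF F(1) by (intro le_degree) (simp add: coeff_H d_def)
    qed
    have "lead_coeff (map_poly \<phi> H) = 1"
      unfolding degH using dF F(1) by (simp add: coeff_H d_def)
    moreover have "coeff (map_poly \<phi> H) j \<in> \<phi> ` {p. tdeg p \<le> m}" for j
      using tdeg_F by (auto simp: coeff_H)
    moreover have "poly (map_poly \<phi> H) (mvar i) = 0"
      using F(2) by (simp add: H_def mp.hom_mult)
    ultimately show "\<exists>F :: ('v, 'k) mpoly poly. lead_coeff F = 1 \<and> degree F = e ^ n \<and>
        (\<forall>j. coeff F j \<in> \<phi> ` {p. tdeg p \<le> m}) \<and> poly F (mvar i) = 0"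
      using degH by blast
  qed
next
  assume F: "\<forall>i. \<exists>F :: ('v, 'k) mpoly poly. lead_coeff F = 1 \<and> degree F = e ^ n \<and>
      (\<forall>j. coeff F j \<in> \<phi> ` {p. tdeg p \<le> m}) \<and> poly F (mvar i) = 0"
  have "finite_hom \<phi>"
    by (rule finite_hom_of_integral_vars[OF assms(1)]) (use F in blast)
  then show "integral_hom \<phi>"
    unfolding integral_hom_def using integral_of_finite_hom[OF is_K_alg_homD(1)[OF assms(1)]] by blast
qed

end
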